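(* Let $\Gamma$ be a row-finite, strongly connected and almost undirected digraph, $F:\Gamma_{Ar}\to\mathbb R$ a potential and $\beta\in\mathbb R$. Assume that $A(\beta)$ is transient. There is a surjective map $m\mapsto E$ from the set of extremal $e^{\beta F}$-conformal measures $m$ on $P(\Gamma)$ to the end space $\mathcal E(\Gamma)$ of $\Gamma$, defined such that $m$ is concentrated on $E$.
   Context: A countable directed graph (digraph) $\Gamma$ consists of countable sets $\Gamma_V$ (vertices) and $\Gamma_{Ar}$ (arrows) with source and range maps $s,r:\Gamma_{Ar}\to\Gamma_V$ (multiple arrows and loops allowed). It is row-finite if $\#s^{-1}(v)<\infty$ for all $v$; strongly connected if for all vertices $v,w$ there is a finite path from $v$ to $w$; almost undirected if there is $N\in\mathbb N$ such that for every arrow $a$ there is a finite path of length at most $N$ from $r(a)$ to $s(a)$. $P(\Gamma)$ is the set of infinite paths $p=(p_i)_{i\ge1}\in(\Gamma_{Ar})^{\mathbb N}$, $r(p_i)=s(p_{i+1})$, with the topology inherited from the product of discrete spaces; $Z(v)=\{p:s(p_1)=v\}$ for a vertex $v$, $Z(a)=\{p:p_1=a\}$ for an arrow $a$; the shift is $\sigma(p)_i=p_{i+1}$. $A(\beta)_{v,w}=\sum_{a\in s^{-1}(v)\cap r^{-1}(w)}e^{-\beta F(a)}$, a matrix over $\Gamma_V$. It is transient if $\sum_{n=0}^\infty A(\beta)^n_{v,v}<\infty$ for all $v$ (for strongly connected $\Gamma$ this is equivalent to $\sum_{n=0}^\infty A(\beta)^n_{v,w}<\infty$ for all $v,w$).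 A non-zero Borel measure $m$ on $P(\Gamma)$ with $m(Z(v))<\infty$ for all $v$ is $e^{\beta F}$-conformal if $m(\sigma(B\cap Z(a)))=e^{\beta F(a)}m(B\cap Z(a))$ for all arrows $a$ and Borel sets $B$. It is extremal if every $e^{\beta F}$-conformal measure $m'\le m$ is of the form $\lambda m$, $\lambda>0$. It is concentrated on $E$ if $m(P(\Gamma)\setminus E)=0$. $\mathrm{Wan}(\Gamma)$ is the set of $p\in P(\Gamma)$ such that for each finite $H\subseteq\Gamma_V$ there is $N$ with $s(p_i)\notin H$ for all $i\ge N$. For $p,q\in\mathrm{Wan}(\Gamma)$ write $p\to q$ if for every finite $H\subseteq\Gamma_V$ and $N\in\mathbb N$ there are $n_1,n_2\ge N$ and a finite path from $s(p_{n_1})$ to $s(q_{n_2})$ none of whose vertices is in $H$; $p\sim q$ means $p\to q$ and $q\to p$. The end space $\mathcal E(\Gamma)$ is the set of $\sim$-equivalence classes (ends) in $\mathrm{Wan}(\Gamma)$. *)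

theory Defs
  imports "HOL-Analysis.Analysis" "Graph_Theory.Arc_Walk"
begin

section \<open>Digraphs\<close>

definition countable_digraph :: "('v, 'a) pre_digraph \<Rightarrow> bool" where
  "countable_digraph G \<longleftrightarrow> wf_digraph G \<and> countable (verts G) \<and> countable (arcs G)"

definition row_finite :: "('v, 'a) pre_digraph \<Rightarrow> bool" where
  "row_finite G \<longleftrightarrow> (\<forall>v \<in> verts G. finite (out_arcs G v))"

text \<open>Unlike the notion of the same name in Graph\_Theory.Digraph\_Component, this does not
  require the digraph to be non-empty.\<close>

definition strongly_connected_digraph :: "('v, 'a) pre_digraph \<Rightarrow> bool" where
  "strongly_connected_digraph G \<longleftrightarrow>
     (\<forall>v \<in> verts G. \<forall>w \<in> verts G. \<exists>p. pre_digraph.awalk G v p w)"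

definition almost_undirected :: "('v, 'a) pre_digraph \<Rightarrow> bool" where
  "almost_undirected G \<longleftrightarrow>
     (\<exists>N::nat. \<forall>a \<in> arcs G. \<exists>p. pre_digraph.awalk G (head G a) p (tail G a) \<and> length p \<le> N)"


section \<open>The space of infinite paths\<close>

text \<open>Infinite paths are indexed from \<open>0\<close>, so \<open>p 0\<close> is the first arrow.\<close>

definition inf_paths :: "('v, 'a) pre_digraph \<Rightarrow> (nat \<Rightarrow> 'a) set" where
  "inf_paths G = {p. (\<forall>i. p i \<in> arcs G) \<and> (\<forall>i. head G (p i) = tail G (p (Suc i)))}"

definition path_topology :: "('v, 'a) pre_digraph \<Rightarrow> (nat \<Rightarrow> 'a) topology" where
  "path_topology G =
     subtopology (product_topology (\<lambda>_. discrete_topology (arcs G)) UNIV) (inf_paths G)"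

definition path_borel :: "('v, 'a) pre_digraph \<Rightarrow> (nat \<Rightarrow> 'a) measure" where
  "path_borel G = sigma (inf_paths G) {U. openin (path_topology G) U}"

definition vertex_cyl :: "('v, 'a) pre_digraph \<Rightarrow> 'v \<Rightarrow> (nat \<Rightarrow> 'a) set" where
  "vertex_cyl G v = {p \<in> inf_paths G. tail G (p 0) = v}"

definition arrow_cyl :: "('v, 'a) pre_digraph \<Rightarrow> 'a \<Rightarrow> (nat \<Rightarrow> 'a) set" where
  "arrow_cyl G a = {p \<in> inf_paths G. p 0 = a}"

definition path_shift :: "(nat \<Rightarrow> 'a) \<Rightarrow> nat \<Rightarrow> 'a" where
  "path_shift p = (\<lambda>i. p (Suc i))"


section \<open>The matrix of the potential\<close>

text \<open>The entries are non-negative, so all sums are taken in \<^typ>\<open>ennreal\<close>, where they always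
  exist.\<close>

definition pot_matrix ::
    "('v, 'a) pre_digraph \<Rightarrow> ('a \<Rightarrow> real) \<Rightarrow> real \<Rightarrow> 'v \<Rightarrow> 'v \<Rightarrow> ennreal" where
  "pot_matrix G F \<beta> v w =
     (\<Sum>\<^sub>\<infinity>a \<in> {a \<in> arcs G. tail G a = v \<and> head G a = w}. ennreal (exp (- \<beta> * F a)))"

fun matrix_power_on :: "'v set \<Rightarrow> ('v \<Rightarrow> 'v \<Rightarrow> ennreal) \<Rightarrow> nat \<Rightarrow> 'v \<Rightarrow> 'v \<Rightarrow> ennreal" where
  "matrix_power_on V A 0 v w = (if v = w then 1 else 0)"
| "matrix_power_on V A (Suc n) v w = (\<Sum>\<^sub>\<infinity>u \<in> V. A v u * matrix_power_on V A n u w)"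

definition transient_on :: "'v set \<Rightarrow> ('v \<Rightarrow> 'v \<Rightarrow> ennreal) \<Rightarrow> bool" where
  "transient_on V A \<longleftrightarrow> (\<forall>v \<in> V. (\<Sum>n. matrix_power_on V A n v v) < \<infinity>)"


section \<open>Conformal measures\<close>

text \<open>The set \<open>path_shift ` (B \<inter> arrow_cyl G a)\<close> is Borel for every Borel set \<open>B\<close>, since the
  shift maps \<open>arrow_cyl G a\<close> homeomorphically onto the open set \<open>vertex_cyl G (head G a)\<close>.\<close>

definition conformal ::
    "('v, 'a) pre_digraph \<Rightarrow> ('a \<Rightarrow> real) \<Rightarrow> real \<Rightarrow> (nat \<Rightarrow> 'a) measure \<Rightarrow> bool" where
  "conformal G F \<beta> m \<longleftrightarrow>
     space m = inf_paths G \<and> sets m = sets (path_borel G) \<and>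
     emeasure m (inf_paths G) \<noteq> 0 \<and>
     (\<forall>v \<in> verts G. emeasure m (vertex_cyl G v) < \<infinity>) \<and>
     (\<forall>a \<in> arcs G. \<forall>B \<in> sets m.
        emeasure m (path_shift ` (B \<inter> arrow_cyl G a)) =
        ennreal (exp (\<beta> * F a)) * emeasure m (B \<inter> arrow_cyl G a))"

text \<open>Conformal measures share their space and \<open>\<sigma>\<close>-algebra, so for them \<open>m' \<le> m\<close> is the setwise
  comparison.\<close>

definition extremal_conformal ::
    "('v, 'a) pre_digraph \<Rightarrow> ('a \<Rightarrow> real) \<Rightarrow> real \<Rightarrow> (nat \<Rightarrow> 'a) measure \<Rightarrow> bool" where
  "extremal_conformal G F \<beta> m \<longleftrightarrow>
     conformal G F \<beta> m \<and>
     (\<forall>m'. conformal G F \<beta> m' \<and> m' \<le> m \<longrightarrow>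
        (\<exists>c::real. c > 0 \<and> m' = scale_measure (ennreal c) m))"

text \<open>Membership in \<^const>\<open>null_sets\<close> includes measurability of the complement of \<open>E\<close>; merely
  asking for \<^const>\<open>emeasure\<close> to be \<open>0\<close> would be vacuous for non-measurable \<open>E\<close>.\<close>

definition concentrated_on :: "'b measure \<Rightarrow> 'b set \<Rightarrow> bool" where
  "concentrated_on m E \<longleftrightarrow> space m - E \<in> null_sets m"


section \<open>The end space\<close>

definition wandering :: "('v, 'a) pre_digraph \<Rightarrow> (nat \<Rightarrow> 'a) set" where
  "wandering G = {p \<in> inf_paths G.
     \<forall>H. finite H \<and> H \<subseteq> verts G \<longrightarrow> (\<exists>N. \<forall>i \<ge> N. tail G (p i) \<notin> H)}"

definition leads_to :: "('v, 'a) pre_digraph \<Rightarrow> (nat \<Rightarrow> 'a) \<Rightarrow> (nat \<Rightarrow> 'a) \<Rightarrow> bool" where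
  "leads_to G p q \<longleftrightarrow>
     (\<forall>H N. finite H \<and> H \<subseteq> verts G \<longrightarrow>
        (\<exists>n\<^sub>1 \<ge> N. \<exists>n\<^sub>2 \<ge> N. \<exists>w.
           pre_digraph.awalk G (tail G (p n\<^sub>1)) w (tail G (q n\<^sub>2)) \<and>
           set (pre_digraph.awalk_verts G (tail G (p n\<^sub>1)) w) \<inter> H = {}))"

definition end_equiv :: "('v, 'a) pre_digraph \<Rightarrow> ((nat \<Rightarrow> 'a) \<times> (nat \<Rightarrow> 'a)) set" where
  "end_equiv G =
     {(p, q). p \<in> wandering G \<and> q \<in> wandering G \<and> leads_to G p q \<and> leads_to G q p}"

definition end_space :: "('v, 'a) pre_digraph \<Rightarrow> (nat \<Rightarrow> 'a) set set" where
  "end_space G = wandering G // end_equiv G"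

end

theory Submission
  imports Defs
begin

text \<open>
  A conformal measure \<open>m\<close> is the same thing as a non-zero function \<open>\<psi> v = m (Z v) \<ge> 0\<close> on the
  vertices that is harmonic for the matrix \<open>A = A(\<beta>)\<close>: conformality makes \<open>\<psi>\<close> harmonic and \<open>\<psi>\<close> determines \<open>m\<close> on
  cylinders (\<open>conformal_harmonic\<close>, \<open>conformal_unique\<close>), and each harmonic function arises in this way
  (\<open>exists_conformal\<close>). More precisely, the set of paths from \<open>v\<close> that are in \<open>D\<close> at time \<open>n\<close> has
  measure \<open>(A\<^sup>n (1\<^sub>D \<psi>)) v\<close>. The Green function \<open>\<Sum>\<^sub>n A\<^sup>n\<close> is finite everywhere by transience and a
  Harnack inequality, so the Borel-Cantelli lemma shows that \<open>m\<close> is concentrated on wandering paths.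

  For a finite set \<open>H\<close> of vertices, a wandering path finally stays in one connected component of the
  complement of \<open>H\<close>, arrows being traversed in both directions. Since the graph is almost
  undirected, two wandering paths are equivalent if and only if they choose the same component for
  every \<open>H\<close> (\<open>end_class_eq\<close>), hence an end is a countable intersection of shift invariant Borel
  sets.

  \<^emph>\<open>An extremal measure lives on one end.\<close> The restriction of \<open>m\<close> to an invariant Borel set is again
  conformal, so that an extremal \<open>m\<close> gives each such set measure zero or full measure. For each \<open>H\<close>
  there are countably many components, and exactly one of them carries \<open>m\<close>. The intersection over
  all \<open>H\<close> carries \<open>m\<close> and is an end.

  \<^emph>\<open>Each end carries an extremal measure.\<close> Let \<open>p\<close> be a path in the end and \<open>x\<close> its first vertex. For
  each finite \<open>H\<close> let \<open>D\<close> be the set of vertices outside \<open>H\<close> that are not in the component chosen by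
  \<open>p\<close>. Consider the harmonic functions \<open>f \<ge> 0\<close> with \<open>f x = 1\<close> and
  \<open>f v \<le> (\<Sum>h\<in>H. G(v,h) f h)\<close> for all \<open>H\<close> and all \<open>v \<in> D\<close>, where \<open>G\<close> is the Green function. They form
  a compact set by the Harnack inequality. It is not empty, for the Martin kernels
  \<open>G(v, w\<^sub>n) / G(x, w\<^sub>n)\<close> along the vertices \<open>w\<^sub>n\<close> of \<open>p\<close> satisfy each of the conditions as soon as \<open>n\<close>
  is large: a walk from \<open>D\<close> to \<open>w\<^sub>n\<close> must pass through \<open>H\<close>. If \<open>f\<close> satisfies the conditions, then
  \<open>f\<close> is bounded on \<open>D\<close> by a potential, so the measure of the paths that are in \<open>D\<close> at time \<open>n\<close> tends
  to zero with \<open>n\<close>; thus the measure of \<open>f\<close> is concentrated on the end. Finally, a harmonic function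
  dominated by \<open>f\<close> satisfies the same inequalities on \<open>D\<close> (\<open>potential_le\<close>), so an extreme point of
  the compact set gives an extremal conformal measure.
\<close>

section \<open>The matrix of the potential as an operator\<close>

locale weighted_digraph = wf_digraph G for G :: "('v, 'a) pre_digraph" +
  fixes F :: "'a \<Rightarrow> real" and \<beta> :: real
  assumes countable_verts: "countable (verts G)"
    and countable_arcs: "countable (arcs G)"
    and finite_out_arcs: "finite (out_arcs G v)"
begin

definition wt :: "'a \<Rightarrow> real" where
  "wt a = exp (- \<beta> * F a)"

text \<open>The matrix \<open>A(\<beta>)\<close> acting on column vectors. The sum runs over arrows and not over vertices, and is
  therefore finite. Outside the vertex set the result is \<open>0\<close>, which allows (super)harmonicity
  to be stated as a relation between functions on the whole type.\<close>

definition mat_op :: "('v \<Rightarrow> ennreal) \<Rightarrow> 'v \<Rightarrow> ennreal" where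
  "mat_op f v = (\<Sum>a\<in>out_arcs G v. ennreal (wt a) * f (head G a))"

definition unit_vec :: "'v \<Rightarrow> 'v \<Rightarrow> ennreal" where
  "unit_vec w v = (if v = w then 1 else 0)"

text \<open>As a function of \<open>v\<close> this is the potential of a unit charge at \<open>w\<close>.\<close>

definition green :: "'v \<Rightarrow> 'v \<Rightarrow> ennreal" where
  "green v w = (\<Sum>n. (mat_op ^^ n) (unit_vec w) v)"

lemma wt_pos: "wt a > 0"
  by (simp add: wt_def)

lemma out_arcs_outside: "v \<notin> verts G \<Longrightarrow> out_arcs G v = {}"
  by auto

lemma mat_op_outside: "v \<notin> verts G \<Longrightarrow> mat_op f v = 0"
  by (simp add: mat_op_def out_arcs_outside)

lemma mat_op_mono_succ:
  assumes "\<And>a. a \<in> arcs G \<Longrightarrow> tail G a = v \<Longrightarrow> f (head G a) \<le> g (head G a)"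
  shows "mat_op f v \<le> mat_op g v"
  unfolding mat_op_def using assms by (intro sum_mono mult_left_mono) auto

lemma mat_op_mono: "f \<le> g \<Longrightarrow> mat_op f \<le> mat_op g"
  by (auto simp: le_fun_def intro: mat_op_mono_succ)

lemma mat_op_pow_mono: "f \<le> g \<Longrightarrow> (mat_op ^^ n) f \<le> (mat_op ^^ n) g"
  by (induction n) (auto intro: mat_op_mono)

lemma mat_op_cmult: "mat_op (\<lambda>u. c * f u) v = c * mat_op f v"
  by (simp add: mat_op_def sum_distrib_left mult_ac)

lemma mat_op_add: "mat_op (\<lambda>u. f u + g u) v = mat_op f v + mat_op g v"
  by (simp add: mat_op_def distrib_left sum.distrib)

lemma mat_op_sum: "mat_op (\<lambda>u. \<Sum>i\<in>I. f i u) v = (\<Sum>i\<in>I. mat_op (f i) v)"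
  unfolding mat_op_def sum_distrib_left by (rule sum.swap)

lemma mat_op_suminf: "mat_op (\<lambda>u. \<Sum>n. f n u) v = (\<Sum>n. mat_op (f n) v)"
  unfolding mat_op_def ennreal_suminf_cmult[symmetric]
  by (rule suminf_sum[symmetric]) (simp add: summableI)

lemma mat_op_pow_cmult: "(mat_op ^^ n) (\<lambda>u. c * f u) v = c * (mat_op ^^ n) f v"
proof (induction n arbitrary: v)
  case (Suc n)
  have "(mat_op ^^ n) (\<lambda>u. c * f u) = (\<lambda>u. c * (mat_op ^^ n) f u)"
    by (rule ext) (rule Suc)
  then show ?case by (simp add: mat_op_cmult)
qed simp

lemma mat_op_pow_sum: "(mat_op ^^ n) (\<lambda>u. \<Sum>i\<in>I. f i u) v = (\<Sum>i\<in>I. (mat_op ^^ n) (f i) v)"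
proof (induction n arbitrary: v)
  case (Suc n)
  have "(mat_op ^^ n) (\<lambda>u. \<Sum>i\<in>I. f i u) = (\<lambda>u. \<Sum>i\<in>I. (mat_op ^^ n) (f i) u)"
    by (rule ext) (rule Suc)
  then show ?case by (simp add: mat_op_sum)
qed simp

lemma mat_op_pow_suminf: "(mat_op ^^ n) (\<lambda>u. \<Sum>k. f k u) v = (\<Sum>k. (mat_op ^^ n) (f k) v)"
proof (induction n arbitrary: v)
  case (Suc n)
  have "(mat_op ^^ n) (\<lambda>u. \<Sum>k. f k u) = (\<lambda>u. \<Sum>k. (mat_op ^^ n) (f k) u)"
    by (rule ext) (rule Suc)
  then show ?case by (simp add: mat_op_suminf)
qed simp

lemma pot_matrix_eq:
  "pot_matrix G F \<beta> v w = (\<Sum>a \<in> {a \<in> out_arcs G v. head G a = w}. ennreal (wt a))"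
proof -
  have "{a \<in> arcs G. tail G a = v \<and> head G a = w} = {a \<in> out_arcs G v. head G a = w}" by auto
  moreover have "finite \<dots>" by (simp add: finite_out_arcs del: in_out_arcs_conv)
  ultimately show ?thesis unfolding pot_matrix_def wt_def
    by (simp only: infsum_finite)
qed

text \<open>Grouping the arrows that leave \<open>v\<close> by their heads turns the sum over arrows into the matrix product.\<close>

lemma infsum_pot_matrix:
  assumes "v \<in> verts G"
  shows "(\<Sum>\<^sub>\<infinity>u \<in> verts G. pot_matrix G F \<beta> v u * f u) = mat_op f v"
proof -
  let ?S = "head G ` out_arcs G v"
  have fin: "finite ?S" by (simp add: finite_out_arcs)
  have "(\<Sum>\<^sub>\<infinity>u \<in> verts G. pot_matrix G F \<beta> v u * f u) = (\<Sum>\<^sub>\<infinity>u \<in> ?S. pot_matrix G F \<beta> v u * f u)"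
  proof (rule infsum_cong_neutral)
    fix u assume "u \<in> verts G - ?S"
    then have "{a \<in> out_arcs G v. head G a = u} = {}" by auto
    then show "pot_matrix G F \<beta> v u * f u = 0" unfolding pot_matrix_eq by (simp only: sum.empty mult_zero_left)
  qed auto
  also have "\<dots> = (\<Sum>u \<in> ?S. pot_matrix G F \<beta> v u * f u)" using fin by (rule infsum_finite)
  also have "\<dots> = (\<Sum>u \<in> ?S. \<Sum>a \<in> {a \<in> out_arcs G v. head G a = u}. ennreal (wt a) * f (head G a))"
    by (intro sum.cong refl) (simp add: pot_matrix_eq sum_distrib_right)
  also have "\<dots> = mat_op f v" unfolding mat_op_def
    by (rule sum.image_gen[OF finite_out_arcs, symmetric])
  finally show ?thesis .
qed

lemma matrix_power_eq:
  "v \<in> verts G \<Longrightarrow>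
    matrix_power_on (verts G) (pot_matrix G F \<beta>) n v w = (mat_op ^^ n) (unit_vec w) v"
proof (induction n arbitrary: v)
  case (Suc n)
  have "matrix_power_on (verts G) (pot_matrix G F \<beta>) (Suc n) v w
      = (\<Sum>\<^sub>\<infinity>u \<in> verts G. pot_matrix G F \<beta> v u * (mat_op ^^ n) (unit_vec w) u)"
    unfolding matrix_power_on.simps by (rule infsum_cong) (simp add: Suc.IH)
  also have "\<dots> = (mat_op ^^ Suc n) (unit_vec w) v"
    using infsum_pot_matrix[OF Suc.prems] by simp
  finally show ?case .
qed (simp add: unit_vec_def)

section \<open>The Green function\<close>

lemma green_eq: "green v w = unit_vec w v + mat_op (\<lambda>u. green u w) v"
proof -
  have "green v w = (\<Sum>n. (mat_op ^^ Suc n) (unit_vec w) v) + (mat_op ^^ 0) (unit_vec w) v"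
    unfolding green_def
    using suminf_offset[of "\<lambda>n. (mat_op ^^ n) (unit_vec w) v" 1] by (simp add: summableI add.commute)
  also have "\<dots> = unit_vec w v + mat_op (\<lambda>u. green u w) v"
    unfolding green_def mat_op_suminf by (simp add: add.commute)
  finally show ?thesis .
qed

lemma green_superharmonic: "mat_op (\<lambda>u. green u w) v \<le> green v w"
  unfolding green_eq[of v w] by simp

lemma green_diag_ge_1: "1 \<le> green v v"
  unfolding green_eq[of v v] by (simp add: unit_vec_def)

text \<open>The Harnack inequality: along one arrow \<open>a\<close> a superharmonic function \<open>f\<close> satisfies
  \<open>wt a * f (head a) \<le> f (tail a)\<close>, so the product of the weights along a walk is a constant that
  serves all \<open>f\<close> at once.\<close>

lemma harnack_walk:
  assumes "awalk x p y"
  shows "\<exists>c::real. c > 0 \<and> (\<forall>f. mat_op f \<le> f \<longrightarrow> ennreal c * f y \<le> f x)"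
  using assms
proof (induction p arbitrary: x)
  case Nil
  then show ?case by (intro exI[of _ 1]) (auto simp: awalk_Nil_iff)
next
  case (Cons a p)
  then have a: "a \<in> arcs G" "tail G a = x" and w: "awalk (head G a) p y"
    by (auto simp: awalk_Cons_iff)
  from Cons.IH[OF w] obtain c :: real where c: "c > 0"
    "\<And>f. mat_op f \<le> f \<Longrightarrow> ennreal c * f y \<le> f (head G a)" by blast
  have "ennreal (wt a * c) * f y \<le> f x" if "mat_op f \<le> f" for f
  proof -
    have "ennreal (wt a * c) * f y = ennreal (wt a) * (ennreal c * f y)"
      using wt_pos[of a] c(1) by (simp add: ennreal_mult mult.assoc)
    also have "\<dots> \<le> ennreal (wt a) * f (head G a)"
      by (intro mult_left_mono c(2) that) simp
    also have "\<dots> \<le> mat_op f x" unfolding mat_op_def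
      using a finite_out_arcs by (intro member_le_sum) auto
    also have "\<dots> \<le> f x" using that by (simp add: le_fun_def)
    finally show ?thesis .
  qed
  then show ?case using c(1) wt_pos[of a] by (intro exI[of _ "wt a * c"]) auto
qed

text \<open>Applying \<open>A\<^sup>n\<close> to a potential removes the first \<open>n\<close> terms of the series that defines it.\<close>

lemma mat_op_pow_green_tendsto_0:
  assumes "green v w < \<infinity>"
  shows "(\<lambda>n. (mat_op ^^ n) (\<lambda>u. green u w) v) \<longlonglongrightarrow> 0"
proof -
  let ?a = "\<lambda>n. (mat_op ^^ n) (unit_vec w) v"
  have tail: "(mat_op ^^ n) (\<lambda>u. green u w) v = (\<Sum>k. ?a (k + n))" for n
    unfolding green_def mat_op_pow_suminf by (simp only: add.commute[of _ n] funpow_add comp_apply)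
  have fin: "?a n < \<infinity>" for n
  proof -
    have "?a n \<le> green v w" unfolding green_def
      using sum_le_suminf[of ?a "{n}"] by (simp add: summableI)
    with assms show ?thesis by (simp add: le_less_trans)
  qed
  define r where "r n = enn2real (?a n)" for n
  have r: "?a n = ennreal (r n)" "0 \<le> r n" for n using fin[of n] by (simp_all add: r_def)
  have "summable r"
  proof (rule summable_suminf_not_top)
    show "(\<Sum>i. ennreal (r i)) \<noteq> top" using assms unfolding green_def r by simp
  qed (rule r)
  moreover have "(\<Sum>k. ?a (k + n)) = ennreal (\<Sum>k. r (k + n))" for n
    unfolding r(1) using \<open>summable r\<close> r(2) by (intro suminf_ennreal2) (auto simp: summable_iff_shift)
  moreover have "(\<lambda>n. \<Sum>k. r (k + n)) \<longlonglongrightarrow> 0"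
    by (rule suminf_exist_split2[OF \<open>summable r\<close>])
  ultimately show ?thesis unfolding tail
    by (simp add: ennreal_tendsto_0_iff suminf_nonneg r(2) summable_iff_shift)
qed

text \<open>A potential of a positive charge on \<open>H\<close> is superharmonic everywhere, and not only off \<open>H\<close>.\<close>

lemma potential_superharmonic:
  "mat_op (\<lambda>v. \<Sum>h\<in>H. green v h * c h) u \<le> (\<Sum>h\<in>H. green u h * c h)"
  unfolding mat_op_sum mult.commute[of _ "c _"] mat_op_cmult
  by (intro sum_mono mult_left_mono green_superharmonic) simp

text \<open>A maximum principle: a harmonic function that is bounded on \<open>D\<close> by some potential carried by the
  boundary \<open>H\<close> is already bounded by the potential \<open>g\<close> of its own boundary values. On \<open>H\<close> this is
  clear because \<open>G(h,h) \<ge> 1\<close>. On \<open>D\<close> one iterates \<open>f = A f\<close>, which improves the bound \<open>f \<le> g + q\<close> to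
  \<open>f \<le> g + A\<^sup>n q\<close>, and \<open>A\<^sup>n q\<close> tends to \<open>0\<close>. The charges \<open>c\<close> are arbitrary, so that
  a bound known for a larger function can be used as hypothesis for a smaller one.\<close>

lemma potential_le:
  assumes D: "\<And>a. a \<in> arcs G \<Longrightarrow> tail G a \<in> D \<Longrightarrow> head G a \<in> D \<union> H"
    and H: "finite H"
    and fin: "\<And>v h. v \<in> D \<Longrightarrow> h \<in> H \<Longrightarrow> green v h < \<infinity>"
    and harm: "mat_op f = f"
    and bound: "\<And>v. v \<in> D \<Longrightarrow> f v \<le> (\<Sum>h\<in>H. green v h * ennreal (c h))"
    and v: "v \<in> D"
  shows "f v \<le> (\<Sum>h\<in>H. green v h * f h)"
proof -
  let ?g = "\<lambda>v. \<Sum>h\<in>H. green v h * f h"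
  let ?q = "\<lambda>v. \<Sum>h\<in>H. green v h * ennreal (c h)"
  have g_super: "mat_op ?g u \<le> ?g u" for u by (rule potential_superharmonic)
  have g_H: "f h \<le> ?g h" if "h \<in> H" for h
  proof -
    have "f h \<le> green h h * f h" using mult_right_mono[OF green_diag_ge_1[of h], of "f h"] by simp
    also have "\<dots> \<le> ?g h" using that H by (intro member_le_sum[where f = "\<lambda>x. green h x * f x"]) auto
    finally show ?thesis .
  qed
  have step: "f u \<le> ?g u + (mat_op ^^ n) ?q u" if "u \<in> D \<union> H" for n u
    using that
  proof (induction n arbitrary: u)
    case 0
    then show ?case
    proof (cases "u \<in> H")
      case False
      with 0 bound have "f u \<le> ?q u" by auto
      then show ?thesis by (simp add: add_increasing)
    qed (auto intro: add_increasing2 g_H)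
  next
    case (Suc n)
    show ?case
    proof (cases "u \<in> H")
      case False
      with Suc.prems have u: "u \<in> D" by auto
      have "f u = mat_op f u" using harm by simp
      also have "\<dots> \<le> mat_op (\<lambda>x. ?g x + (mat_op ^^ n) ?q x) u"
        using D u by (intro mat_op_mono_succ Suc.IH) auto
      also have "\<dots> = mat_op ?g u + (mat_op ^^ Suc n) ?q u" by (simp add: mat_op_add)
      also have "\<dots> \<le> ?g u + (mat_op ^^ Suc n) ?q u" by (intro add_mono g_super) simp
      finally show ?thesis .
    qed (auto intro: add_increasing2 g_H)
  qed
  have "(\<lambda>n. (mat_op ^^ n) ?q v) \<longlonglongrightarrow> (\<Sum>h\<in>H. ennreal (c h) * 0)"
    unfolding mat_op_pow_sum mult.commute[of "green _ _"] mat_op_pow_cmult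
    using fin v by (intro tendsto_sum ennreal_tendsto_cmult mat_op_pow_green_tendsto_0) auto
  then have "(\<lambda>n. ?g v + (mat_op ^^ n) ?q v) \<longlonglongrightarrow> ?g v + 0" by (intro tendsto_add tendsto_const) simp
  then show ?thesis using step[of v] v by (intro LIMSEQ_le_const[of _ "?g v"]) auto
qed

text \<open>A walk from \<open>D\<close> to a vertex outside \<open>D\<close> meets \<open>H\<close>. Instead of cutting walks at \<open>H\<close>, the proof compares the
  partial sums of the Green function with the superharmonic function on the right, which
  dominates them on \<open>H\<close>.\<close>

lemma green_le_through:
  assumes D: "\<And>a. a \<in> arcs G \<Longrightarrow> tail G a \<in> D \<Longrightarrow> head G a \<in> D \<union> H"
    and H: "finite H" and w: "w \<notin> D" and v: "v \<in> D"
  shows "green v w \<le> (\<Sum>h\<in>H. green v h * green h w)"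
proof -
  let ?g = "\<lambda>v. \<Sum>h\<in>H. green v h * green h w"
  let ?s = "\<lambda>n v. \<Sum>k<n. (mat_op ^^ k) (unit_vec w) v"
  have g_super: "mat_op ?g u \<le> ?g u" for u by (rule potential_superharmonic)
  have g_H: "green h w \<le> ?g h" if "h \<in> H" for h
  proof -
    have "green h w \<le> green h h * green h w" using mult_right_mono[OF green_diag_ge_1[of h], of "green h w"] by simp
    also have "\<dots> \<le> ?g h" using that H by (intro member_le_sum[where f = "\<lambda>x. green h x * green x w"]) auto
    finally show ?thesis .
  qed
  have step: "?s n u \<le> ?g u" if "u \<in> D \<union> H" for n u
    using that
  proof (induction n arbitrary: u)
    case (Suc n)
    show ?case
    proof (cases "u \<in> H")
      case True
      have "?s (Suc n) u \<le> green u w" unfolding green_def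
        by (rule sum_le_suminf) (auto simp: summableI)
      also have "\<dots> \<le> ?g u" by (rule g_H[OF True])
      finally show ?thesis .
    next
      case False
      with Suc.prems have u: "u \<in> D" by auto
      with w have "unit_vec w u = 0" by (auto simp: unit_vec_def)
      then have "?s (Suc n) u = mat_op (?s n) u"
        unfolding sum.lessThan_Suc_shift mat_op_sum by simp
      also have "\<dots> \<le> mat_op ?g u" using D u by (intro mat_op_mono_succ Suc.IH) auto
      also have "\<dots> \<le> ?g u" by (rule g_super)
      finally show ?thesis .
    qed
  qed simp
  show ?thesis unfolding green_def[of v w]
    using v by (intro suminf_le_const summableI step) auto
qed

end

locale transient_digraph = weighted_digraph G F \<beta>
  for G :: "('v, 'a) pre_digraph" and F \<beta> +
  assumes strongly_connected: "v \<in> verts G \<Longrightarrow> w \<in> verts G \<Longrightarrow> \<exists>p. awalk v p w"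
    and transient: "transient_on (verts G) (pot_matrix G F \<beta>)"
begin

lemma harnack:
  assumes "x \<in> verts G" "y \<in> verts G"
  shows "\<exists>c::real. c > 0 \<and> (\<forall>f. mat_op f \<le> f \<longrightarrow> ennreal c * f y \<le> f x)"
  using strongly_connected[OF assms] harnack_walk by blast

text \<open>Transience concerns the diagonal; the Harnack inequality for \<open>\<lambda>u. green u w\<close> bounds the other entries.\<close>

lemma green_finite:
  assumes "v \<in> verts G" "w \<in> verts G"
  shows "green v w < \<infinity>"
proof -
  from harnack[OF assms(2,1)] obtain c :: real where c: "c > 0"
    "ennreal c * green v w \<le> green w w"
    using green_superharmonic[of w] by (auto simp: le_fun_def)
  have "green w w < \<infinity>"
    using transient assms(2) unfolding transient_on_def green_def by (simp add: matrix_power_eq)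
  with c have "ennreal c * green v w < \<infinity>" by (simp add: le_less_trans)
  with c(1) show ?thesis by (auto simp: ennreal_mult_less_top)
qed

lemma green_pos:
  assumes "v \<in> verts G" "w \<in> verts G"
  shows "green v w > 0"
proof -
  from harnack[OF assms] obtain c :: real where c: "c > 0"
    "ennreal c * green w w \<le> green v w"
    using green_superharmonic[of w] by (auto simp: le_fun_def)
  have "0 < ennreal c * green w w" using c(1) green_diag_ge_1[of w]
    by (auto simp: ennreal_zero_less_mult_iff intro: less_le_trans[of 0 1])
  with c(2) show ?thesis by (rule less_le_trans[rotated])
qed

lemma green_outside: "v \<notin> verts G \<Longrightarrow> w \<in> verts G \<Longrightarrow> green v w = 0"
  unfolding green_eq[of v w] by (auto simp: unit_vec_def mat_op_outside)

end

section \<open>Borel sets of path space\<close>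

context weighted_digraph begin

definition prefix_cyl :: "'a list \<Rightarrow> (nat \<Rightarrow> 'a) set" where
  "prefix_cyl xs = {p \<in> inf_paths G. \<forall>i<length xs. p i = xs ! i}"

definition eventually_in :: "'v set \<Rightarrow> (nat \<Rightarrow> 'a) set" where
  "eventually_in D = {p \<in> inf_paths G. \<exists>N. \<forall>i\<ge>N. tail G (p i) \<in> D}"

lemma inf_paths_arc: "p \<in> inf_paths G \<Longrightarrow> p i \<in> arcs G"
  and inf_paths_step: "p \<in> inf_paths G \<Longrightarrow> tail G (p (Suc i)) = head G (p i)"
  by (auto simp: inf_paths_def)

lemma inf_paths_vertex: "p \<in> inf_paths G \<Longrightarrow> tail G (p i) \<in> verts G"
  by (auto intro!: tail_in_verts inf_paths_arc)

lemma path_shift_in: "p \<in> inf_paths G \<Longrightarrow> path_shift p \<in> inf_paths G"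
  by (auto simp: inf_paths_def path_shift_def)

lemma path_shift_apply: "path_shift p n = p (Suc n)"
  by (simp add: path_shift_def)

lemma path_shift_pow: "(path_shift ^^ n) p i = p (i + n)"
  by (induction n arbitrary: i) (auto simp: path_shift_def)

lemma path_shift_pow_in: "p \<in> inf_paths G \<Longrightarrow> (path_shift ^^ n) p \<in> inf_paths G"
  by (induction n) (auto intro: path_shift_in)

lemma cons_in_inf_paths:
  "a \<in> arcs G \<Longrightarrow> q \<in> vertex_cyl G (head G a) \<Longrightarrow> case_nat a q \<in> inf_paths G"
  by (auto simp: inf_paths_def vertex_cyl_def split: nat.splits)

lemma path_shift_cons: "path_shift (case_nat a q) = q"
  by (auto simp: path_shift_def)

lemma space_path_borel [simp]: "space (path_borel G) = inf_paths G"
  unfolding path_borel_def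
  by (intro space_measure_of) (auto simp: path_topology_def dest: openin_imp_subset)

lemma sets_path_borel:
  "sets (path_borel G) = sigma_sets (inf_paths G) {U. openin (path_topology G) U}"
  unfolding path_borel_def
  by (intro sets_measure_of) (auto simp: path_topology_def dest: openin_imp_subset)

lemma coordinate_measurable: "{p \<in> inf_paths G. p n \<in> B} \<in> sets (path_borel G)"
proof -
  let ?X = "product_topology (\<lambda>_::nat. discrete_topology (arcs G)) UNIV"
  have "openin ?X {p \<in> topspace ?X. p n \<in> B \<inter> arcs G}"
    by (rule openin_continuous_map_preimage[where Y = "discrete_topology (arcs G)"])
      (auto intro: continuous_map_product_projection)
  then have "openin (path_topology G) ({p \<in> topspace ?X. p n \<in> B \<inter> arcs G} \<inter> inf_paths G)"
    unfolding path_topology_def openin_subtopology by blast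
  moreover have "{p \<in> topspace ?X. p n \<in> B \<inter> arcs G} \<inter> inf_paths G = {p \<in> inf_paths G. p n \<in> B}"
    by (auto simp: inf_paths_def)
  ultimately show ?thesis unfolding sets_path_borel by (auto intro: sigma_sets.Basic)
qed

lemma vertex_measurable: "{p \<in> inf_paths G. tail G (p n) \<in> D} \<in> sets (path_borel G)"
  using coordinate_measurable[of n "tail G -` D"] by simp

lemma vertex_cyl_measurable: "vertex_cyl G v \<in> sets (path_borel G)"
  using vertex_measurable[of 0 "{v}"] by (simp add: vertex_cyl_def)

lemma always_in_measurable:
  "(\<Inter>i\<in>{N..}. {p \<in> inf_paths G. tail G (p i) \<in> D}) \<in> sets (path_borel G)"
  using vertex_measurable by (intro sets.countable_INT') auto

lemma eventually_in_measurable: "eventually_in D \<in> sets (path_borel G)"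
proof -
  have "eventually_in D = (\<Union>N. \<Inter>i\<in>{N..}. {p \<in> inf_paths G. tail G (p i) \<in> D})"
    by (auto simp: eventually_in_def)
  also have "\<dots> \<in> sets (path_borel G)"
    using always_in_measurable by (intro sets.countable_UN') auto
  finally show ?thesis .
qed

lemma prefix_cyl_measurable: "prefix_cyl xs \<in> sets (path_borel G)"
proof -
  have "prefix_cyl xs = (\<Inter>i\<in>{..<length xs}. {p \<in> inf_paths G. p i \<in> {xs ! i}}) \<inter> inf_paths G"
    by (auto simp: prefix_cyl_def)
  also have "\<dots> \<in> sets (path_borel G)"
  proof (cases "xs = []")
    case False
    then show ?thesis
      by (intro sets.Int sets.finite_INT coordinate_measurable) (auto intro: sets.top[of "path_borel G", simplified])
  qed (auto intro: sets.top[of "path_borel G", simplified])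
  finally show ?thesis .
qed

text \<open>There are only countably many cylinders, because there are countably many finite lists of arrows;
  so a \<open>\<sigma>\<close>-algebra that contains the cylinders contains the open sets.\<close>

lemma open_path_set_eq_Union_cylinders:
  assumes "openin (path_topology G) U"
  shows "U = \<Union> (prefix_cyl ` {xs \<in> lists (arcs G). prefix_cyl xs \<subseteq> U})"
proof (intro equalityI subsetI)
  fix p assume p: "p \<in> U"
  let ?X = "product_topology (\<lambda>_::nat. discrete_topology (arcs G)) UNIV"
  from assms obtain T where T: "openin ?X T" "U = T \<inter> inf_paths G"
    unfolding path_topology_def openin_subtopology by blast
  with p have pT: "p \<in> T" "p \<in> inf_paths G" by auto
  from T(1) pT obtain B where B: "finite {i. B i \<noteq> arcs G}" "p \<in> (\<Pi>\<^sub>E i\<in>UNIV. B i)" "(\<Pi>\<^sub>E i\<in>UNIV. B i) \<subseteq> T"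
    unfolding openin_product_topology_alt by fastforce
  from B(1) obtain n where n: "\<And>i. B i \<noteq> arcs G \<Longrightarrow> i < n"
    unfolding finite_nat_set_iff_bounded by auto
  have "prefix_cyl (map p [0..<n]) \<subseteq> U"
  proof
    fix q assume q: "q \<in> prefix_cyl (map p [0..<n])"
    have "q i \<in> B i" for i
    proof (cases "B i = arcs G")
      case True
      with q show ?thesis by (auto simp: prefix_cyl_def inf_paths_def)
    next
      case False
      from n[OF this] q have "q i = p i" by (auto simp: prefix_cyl_def)
      with B(2) show ?thesis by auto
    qed
    with B(3) T(2) q show "q \<in> U" by (auto simp: prefix_cyl_def)
  qed
  moreover have "p \<in> prefix_cyl (map p [0..<n])" using pT by (auto simp: prefix_cyl_def)
  moreover have "map p [0..<n] \<in> lists (arcs G)" using pT by (auto simp: inf_paths_arc)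
  ultimately show "p \<in> \<Union> (prefix_cyl ` {xs \<in> lists (arcs G). prefix_cyl xs \<subseteq> U})" by blast
qed auto

lemma sets_path_borel_generated:
  assumes sub: "\<And>X. X \<in> \<G> \<Longrightarrow> X \<in> sets (path_borel G)"
    and gen: "\<And>xs. xs \<in> lists (arcs G) \<Longrightarrow> prefix_cyl xs \<in> sigma_sets (inf_paths G) \<G>"
  shows "sets (path_borel G) = sigma_sets (inf_paths G) \<G>"
proof
  have "\<G> \<subseteq> Pow (inf_paths G)" using sub sets.sets_into_space[of _ "path_borel G"] by auto
  then interpret sigma_algebra "inf_paths G" "sigma_sets (inf_paths G) \<G>"
    by (rule sigma_algebra_sigma_sets)
  have "U \<in> sigma_sets (inf_paths G) \<G>" if "openin (path_topology G) U" for U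
    by (subst open_path_set_eq_Union_cylinders[OF that])
      (auto intro!: countable_UN' gen countable_subset[OF _ countable_lists[OF countable_arcs]])
  then show "sets (path_borel G) \<subseteq> sigma_sets (inf_paths G) \<G>"
    unfolding sets_path_borel by (intro sigma_sets_mono) auto
  show "sigma_sets (inf_paths G) \<G> \<subseteq> sets (path_borel G)"
    using sub sets.sigma_sets_subset[of \<G> "path_borel G"] by auto
qed

lemma measurable_path_borelI:
  assumes f: "f \<in> space M \<rightarrow> inf_paths G"
    and coord: "\<And>n b. b \<in> arcs G \<Longrightarrow> {x \<in> space M. f x n = b} \<in> sets M"
  shows "f \<in> measurable M (path_borel G)"
proof (rule measurable_sigma_sets)
  show "sets (path_borel G) = sigma_sets (inf_paths G) (prefix_cyl ` lists (arcs G))"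
    by (rule sets_path_borel_generated) (auto intro: prefix_cyl_measurable sigma_sets.Basic)
  fix X assume "X \<in> prefix_cyl ` lists (arcs G)"
  then obtain xs where xs: "xs \<in> lists (arcs G)" "X = prefix_cyl xs" by auto
  have "f -` X \<inter> space M = (\<Inter>i\<in>{..<length xs}. {x \<in> space M. f x i = xs ! i}) \<inter> space M"
    using f by (auto simp: xs prefix_cyl_def)
  also have "\<dots> \<in> sets M"
  proof (cases "xs = []")
    case False
    with xs show ?thesis by (intro sets.Int sets.finite_INT coord) auto
  qed auto
  finally show "f -` X \<inter> space M \<in> sets M" .
qed (use f in \<open>auto simp: prefix_cyl_def\<close>)

lemma path_shift_measurable: "path_shift \<in> measurable (path_borel G) (path_borel G)"
  using coordinate_measurable[of _ "{_}"]
  by (intro measurable_path_borelI) (auto simp: path_shift_in path_shift_apply)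

lemma path_shift_pow_measurable: "path_shift ^^ n \<in> measurable (path_borel G) (path_borel G)"
proof (induction n)
  case (Suc n)
  then show ?case unfolding funpow.simps by (rule measurable_comp[OF _ path_shift_measurable])
qed (simp add: id_def)

text \<open>The shift is injective on the cylinder of \<open>a\<close>; its inverse there prefixes the arrow \<open>a\<close>, and the image
  in question is a preimage under this measurable inverse.\<close>

lemma path_shift_image_measurable:
  assumes "a \<in> arcs G" "B \<in> sets (path_borel G)"
  shows "path_shift ` (B \<inter> arrow_cyl G a) \<in> sets (path_borel G)"
proof -
  let ?Z = "vertex_cyl G (head G a)"
  let ?R = "restrict_space (path_borel G) ?Z"
  have Z: "?Z \<inter> inf_paths G = ?Z" by (auto simp: vertex_cyl_def)
  have sp: "space ?R = ?Z" by (simp add: space_restrict_space Z)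
  have "case_nat a \<in> measurable ?R (path_borel G)"
  proof (rule measurable_path_borelI)
    fix n b
    have "{x \<in> ?Z. case_nat a x n = b} \<in> sets (path_borel G)"
    proof (cases n)
      case 0
      then show ?thesis using vertex_cyl_measurable by (cases "a = b") auto
    next
      case (Suc k)
      have "{x \<in> ?Z. case_nat a x n = b} = ?Z \<inter> {p \<in> inf_paths G. p k \<in> {b}}"
        by (auto simp: Suc vertex_cyl_def)
      then show ?thesis using vertex_cyl_measurable coordinate_measurable by (simp only: sets.Int)
    qed
    then show "{x \<in> space ?R. case_nat a x n = b} \<in> sets ?R"
      unfolding sp using vertex_cyl_measurable Z by (subst sets_restrict_space_iff) auto
  qed (use assms sp in \<open>auto intro: cons_in_inf_paths\<close>)
  then have "case_nat a -` B \<inter> space ?R \<in> sets ?R" using assms(2) by (rule measurable_sets)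
  then have "case_nat a -` B \<inter> ?Z \<in> sets (path_borel G)"
    unfolding sp using sets_restrict_space_iff[of ?Z "path_borel G"] vertex_cyl_measurable Z by auto
  also have "case_nat a -` B \<inter> ?Z = path_shift ` (B \<inter> arrow_cyl G a)"
  proof (intro equalityI subsetI)
    fix q assume q: "q \<in> case_nat a -` B \<inter> ?Z"
    then have "case_nat a q \<in> B \<inter> arrow_cyl G a"
      using cons_in_inf_paths[OF assms(1)] by (auto simp: arrow_cyl_def)
    then show "q \<in> path_shift ` (B \<inter> arrow_cyl G a)"
      by (intro image_eqI[of _ _ "case_nat a q"]) (auto simp: path_shift_cons)
  next
    fix q assume "q \<in> path_shift ` (B \<inter> arrow_cyl G a)"
    then obtain p where p: "p \<in> B" "p \<in> inf_paths G" "p 0 = a" "q = path_shift p"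
      by (auto simp: arrow_cyl_def)
    have "case_nat a q = p" unfolding p(4) p(3)[symmetric]
      by (auto simp: path_shift_def split: nat.splits)
    with p show "q \<in> case_nat a -` B \<inter> ?Z"
      using path_shift_in[OF p(2)] inf_paths_step[OF p(2), of 0]
      by (auto simp: vertex_cyl_def path_shift_apply)
  qed
  finally show ?thesis .
qed

lemma arrow_shift_eq:
  "path_shift ` ({p \<in> inf_paths G. path_shift p \<in> S} \<inter> arrow_cyl G a) = S \<inter> vertex_cyl G (head G a)"
  if "a \<in> arcs G"
proof (intro equalityI subsetI)
  fix q assume "q \<in> S \<inter> vertex_cyl G (head G a)"
  then show "q \<in> path_shift ` ({p \<in> inf_paths G. path_shift p \<in> S} \<inter> arrow_cyl G a)"
    using cons_in_inf_paths[OF that]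
    by (intro image_eqI[of _ _ "case_nat a q"]) (auto simp: path_shift_cons arrow_cyl_def)
qed (auto simp: arrow_cyl_def vertex_cyl_def path_shift_in path_shift_apply inf_paths_step)

lemma shift_preimage_measurable:
  "S \<in> sets (path_borel G) \<Longrightarrow> {p \<in> inf_paths G. path_shift p \<in> S} \<in> sets (path_borel G)"
  using measurable_sets[OF path_shift_measurable] by (auto simp: vimage_def Int_def conj_commute)

lemma arrow_cyl_measurable: "arrow_cyl G a \<in> sets (path_borel G)"
  using coordinate_measurable[of 0 "{a}"] by (simp add: arrow_cyl_def)

section \<open>Conformal measures\<close>

lemma wt_inverse: "ennreal (exp (\<beta> * F a)) * (ennreal (wt a) * x) = x"
  by (simp add: wt_def mult.assoc[symmetric] ennreal_mult[symmetric] exp_add[symmetric])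

lemma conformal_sets: "conformal G F \<beta> m \<Longrightarrow> sets m = sets (path_borel G)"
  and conformal_space: "conformal G F \<beta> m \<Longrightarrow> space m = inf_paths G"
  and conformal_nonzero: "conformal G F \<beta> m \<Longrightarrow> emeasure m (inf_paths G) \<noteq> 0"
  by (auto simp: conformal_def)

lemma vertex_cyl_outside: "v \<notin> verts G \<Longrightarrow> vertex_cyl G v = {}"
  using inf_paths_vertex by (auto simp: vertex_cyl_def)

lemma conformal_vertex_finite: "conformal G F \<beta> m \<Longrightarrow> emeasure m (vertex_cyl G v) < \<infinity>"
  by (cases "v \<in> verts G") (auto simp: conformal_def vertex_cyl_outside)

text \<open>Conformality for sets of the form \<open>B = \<sigma>\<^sup>-\<^sup>1 S\<close>. All Borel subsets of the cylinder of \<open>a\<close> have this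
  form, so the equation characterises conformality, as the next lemma records; it avoids
  images under the shift.\<close>

lemma conformal_arrow:
  assumes m: "conformal G F \<beta> m" and S: "S \<in> sets (path_borel G)" and a: "a \<in> arcs G"
  shows "emeasure m ({p \<in> inf_paths G. path_shift p \<in> S} \<inter> arrow_cyl G a)
       = ennreal (wt a) * emeasure m (S \<inter> vertex_cyl G (head G a))" (is "emeasure m ?A = _")
proof -
  have "emeasure m (S \<inter> vertex_cyl G (head G a)) = ennreal (exp (\<beta> * F a)) * emeasure m ?A"
    using m a shift_preimage_measurable[OF S] arrow_shift_eq[OF a, of S] unfolding conformal_def by metis
  then have "ennreal (wt a) * emeasure m (S \<inter> vertex_cyl G (head G a))
      = ennreal (exp (\<beta> * F a)) * (ennreal (wt a) * emeasure m ?A)" by (simp add: mult_ac)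
  then show ?thesis by (simp only: wt_inverse)
qed

lemma conformalI:
  assumes "space m = inf_paths G" and sets: "sets m = sets (path_borel G)"
    and "emeasure m (inf_paths G) \<noteq> 0" and "\<And>v. v \<in> verts G \<Longrightarrow> emeasure m (vertex_cyl G v) < \<infinity>"
    and arrow: "\<And>a S. a \<in> arcs G \<Longrightarrow> S \<in> sets (path_borel G) \<Longrightarrow>
      emeasure m ({p \<in> inf_paths G. path_shift p \<in> S} \<inter> arrow_cyl G a)
       = ennreal (wt a) * emeasure m (S \<inter> vertex_cyl G (head G a))"
  shows "conformal G F \<beta> m"
  unfolding conformal_def
proof (intro conjI ballI assms(1-4))
  fix a B assume a: "a \<in> arcs G" and B: "B \<in> sets m"
  let ?S = "path_shift ` (B \<inter> arrow_cyl G a)"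
  have S: "?S \<in> sets (path_borel G)" using path_shift_image_measurable a B sets by auto
  have inj: "p = q" if "p \<in> arrow_cyl G a" "q \<in> arrow_cyl G a" "path_shift p = path_shift q" for p q
  proof
    fix i show "p i = q i"
      using that by (cases i) (auto simp: arrow_cyl_def path_shift_def fun_eq_iff)
  qed
  have "B \<inter> arrow_cyl G a = {p \<in> inf_paths G. path_shift p \<in> ?S} \<inter> arrow_cyl G a"
    using inj by (auto simp: arrow_cyl_def)
  moreover have "?S \<inter> vertex_cyl G (head G a) = ?S"
    by (auto simp: arrow_cyl_def vertex_cyl_def path_shift_in path_shift_apply inf_paths_step)
  ultimately have "emeasure m (B \<inter> arrow_cyl G a) = ennreal (wt a) * emeasure m ?S"
    using arrow[OF a S] by simp
  then show "emeasure m ?S = ennreal (exp (\<beta> * F a)) * emeasure m (B \<inter> arrow_cyl G a)"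
    by (simp add: wt_inverse)
qed

text \<open>Prefixing an arrow to the paths of \<open>S\<close> acts on the vector \<open>\<lambda>u. m (S \<inter> Z u)\<close> as the matrix does. All
  quantitative facts on conformal measures are instances of this.\<close>

lemma conformal_shift:
  assumes m: "conformal G F \<beta> m" and S: "S \<in> sets (path_borel G)"
  shows "emeasure m ({p \<in> inf_paths G. path_shift p \<in> S} \<inter> vertex_cyl G v)
       = mat_op (\<lambda>u. emeasure m (S \<inter> vertex_cyl G u)) v"
proof -
  let ?T = "{p \<in> inf_paths G. path_shift p \<in> S}"
  have Un: "?T \<inter> vertex_cyl G v = (\<Union>a\<in>out_arcs G v. ?T \<inter> arrow_cyl G a)"
    by (auto simp: vertex_cyl_def arrow_cyl_def inf_paths_arc)
  have "(\<lambda>a. ?T \<inter> arrow_cyl G a) ` out_arcs G v \<subseteq> sets m"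
    unfolding conformal_sets[OF m]
    by (intro image_subsetI sets.Int shift_preimage_measurable[OF S] arrow_cyl_measurable)
  moreover have "disjoint_family_on (\<lambda>a. ?T \<inter> arrow_cyl G a) (out_arcs G v)"
    by (auto simp: disjoint_family_on_def arrow_cyl_def)
  ultimately have "emeasure m (?T \<inter> vertex_cyl G v) = (\<Sum>a\<in>out_arcs G v. emeasure m (?T \<inter> arrow_cyl G a))"
    unfolding Un using finite_out_arcs by (intro sum_emeasure[symmetric])
  also have "\<dots> = mat_op (\<lambda>u. emeasure m (S \<inter> vertex_cyl G u)) v"
    unfolding mat_op_def by (intro sum.cong refl conformal_arrow[OF m S]) auto
  finally show ?thesis .
qed

lemma conformal_shift_pow:
  assumes m: "conformal G F \<beta> m" and S: "S \<in> sets (path_borel G)"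
  shows "emeasure m ({p \<in> inf_paths G. (path_shift ^^ n) p \<in> S} \<inter> vertex_cyl G v)
       = (mat_op ^^ n) (\<lambda>u. emeasure m (S \<inter> vertex_cyl G u)) v"
proof (induction n arbitrary: v)
  case 0
  have "{p \<in> inf_paths G. p \<in> S} \<inter> vertex_cyl G v = S \<inter> vertex_cyl G v" by (auto simp: vertex_cyl_def)
  then show ?case by simp
next
  case (Suc n)
  let ?T = "{p \<in> inf_paths G. (path_shift ^^ n) p \<in> S}"
  have "?T \<in> sets (path_borel G)"
    using measurable_sets[OF path_shift_pow_measurable S, of n] by (auto simp: vimage_def Int_def conj_commute)
  from conformal_shift[OF m this, of v]
  have "emeasure m ({p \<in> inf_paths G. path_shift p \<in> ?T} \<inter> vertex_cyl G v)
      = mat_op ((mat_op ^^ n) (\<lambda>u. emeasure m (S \<inter> vertex_cyl G u))) v"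
    unfolding Suc .
  moreover have "{p \<in> inf_paths G. path_shift p \<in> ?T} = {p \<in> inf_paths G. (path_shift ^^ Suc n) p \<in> S}"
    by (auto simp: path_shift_in funpow_swap1)
  ultimately show ?case by simp
qed

text \<open>The paths in question form the preimage, under the \<open>n\<close>-th power of the shift, of the paths that
  start in \<open>D\<close>.\<close>

lemma conformal_visit:
  assumes m: "conformal G F \<beta> m"
  shows "emeasure m {p \<in> vertex_cyl G v. tail G (p n) \<in> D}
       = (mat_op ^^ n) (\<lambda>u. if u \<in> D then emeasure m (vertex_cyl G u) else 0) v"
proof -
  let ?S = "{p \<in> inf_paths G. tail G (p 0) \<in> D}"
  have "?S \<inter> vertex_cyl G u = (if u \<in> D then vertex_cyl G u else {})" for u
    by (auto simp: vertex_cyl_def)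
  then have "(\<lambda>u. emeasure m (?S \<inter> vertex_cyl G u)) = (\<lambda>u. if u \<in> D then emeasure m (vertex_cyl G u) else 0)"
    by auto
  moreover have "{p \<in> inf_paths G. (path_shift ^^ n) p \<in> ?S} \<inter> vertex_cyl G v = {p \<in> vertex_cyl G v. tail G (p n) \<in> D}"
    by (auto simp: path_shift_pow path_shift_pow_in vertex_cyl_def)
  ultimately show ?thesis using conformal_shift_pow[OF m vertex_measurable[of 0 D], of n v] by simp
qed

lemma conformal_harmonic:
  assumes "conformal G F \<beta> m"
  shows "mat_op (\<lambda>u. emeasure m (vertex_cyl G u)) = (\<lambda>u. emeasure m (vertex_cyl G u))"
proof
  fix v
  have "{p \<in> vertex_cyl G v. tail G (p 1) \<in> UNIV} = vertex_cyl G v" by auto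
  then show "mat_op (\<lambda>u. emeasure m (vertex_cyl G u)) v = emeasure m (vertex_cyl G v)"
    using conformal_visit[OF assms, of v 1 UNIV] by simp
qed

lemma null_set_by_vertices:
  assumes m: "conformal G F \<beta> m" and S: "S \<in> sets (path_borel G)"
    and null: "\<And>v. v \<in> verts G \<Longrightarrow> emeasure m (S \<inter> vertex_cyl G v) = 0"
  shows "S \<in> null_sets m"
proof -
  have "S \<subseteq> inf_paths G" using sets.sets_into_space[OF S] by simp
  then have "S = (\<Union>v\<in>verts G. S \<inter> vertex_cyl G v)" using inf_paths_vertex by (auto simp: vertex_cyl_def)
  also have "\<dots> \<in> null_sets m"
    using null S vertex_cyl_measurable
    by (intro null_sets_UN' countable_verts) (auto simp: null_sets_def conformal_sets[OF m])
  finally show ?thesis .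
qed

lemma conformal_vertex_nonzero:
  assumes "conformal G F \<beta> m" shows "\<exists>v\<in>verts G. emeasure m (vertex_cyl G v) > 0"
proof (rule ccontr)
  assume "\<not> ?thesis"
  then have "emeasure m (inf_paths G \<inter> vertex_cyl G v) = 0" if "v \<in> verts G" for v
    using that by (auto simp: vertex_cyl_def Int_def not_less)
  then have "inf_paths G \<in> null_sets m"
    by (intro null_set_by_vertices[OF assms]) (auto intro: sets.top[of "path_borel G", simplified])
  with conformal_nonzero[OF assms] show False by (auto simp: null_sets_def)
qed

text \<open>Cylinders are obtained from the sets \<open>Z v\<close> by prefixing arrows, hence the values on the sets
  \<open>Z v\<close> determine the measure of each cylinder.\<close>

lemma conformal_unique:
  assumes m: "conformal G F \<beta> m" "conformal G F \<beta> m'"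
    and eq: "\<And>v. v \<in> verts G \<Longrightarrow> emeasure m (vertex_cyl G v) = emeasure m' (vertex_cyl G v)"
  shows "m = m'"
proof (rule measure_eqI_generator_eq_countable)
  let ?E = "insert {} {prefix_cyl xs \<inter> vertex_cyl G v | xs v. xs \<in> lists (arcs G) \<and> v \<in> verts G}"
  let ?A = "vertex_cyl G ` verts G"
  show "?A \<subseteq> ?E"
  proof
    fix X assume "X \<in> ?A"
    then obtain v where "v \<in> verts G" "X = prefix_cyl [] \<inter> vertex_cyl G v"
      by (auto simp: prefix_cyl_def vertex_cyl_def)
    then show "X \<in> ?E" using lists.Nil by blast
  qed
  show "\<Union>?A = inf_paths G" using inf_paths_vertex by (auto simp: vertex_cyl_def)
  show "countable ?A" using countable_verts by simp
  show "emeasure m X \<noteq> \<infinity>" if "X \<in> ?A" for X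
    using that conformal_vertex_finite[OF m(1)] by (auto simp: less_top)
  show "?E \<subseteq> Pow (inf_paths G)" by (auto simp: vertex_cyl_def)
  have gen: "sets (path_borel G) = sigma_sets (inf_paths G) ?E"
  proof (rule sets_path_borel_generated)
    interpret sigma_algebra "inf_paths G" "sigma_sets (inf_paths G) ?E"
      by (rule sigma_algebra_sigma_sets) (auto simp: vertex_cyl_def)
    fix xs assume xs: "xs \<in> lists (arcs G)"
    have "prefix_cyl xs = (\<Union>v\<in>verts G. prefix_cyl xs \<inter> vertex_cyl G v)"
      using inf_paths_vertex by (auto simp: vertex_cyl_def prefix_cyl_def)
    also have "\<dots> \<in> sigma_sets (inf_paths G) ?E"
      using xs by (intro countable_UN' countable_verts) (blast intro: sigma_sets.Basic)+
    finally show "prefix_cyl xs \<in> sigma_sets (inf_paths G) ?E" .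
  qed (auto intro: prefix_cyl_measurable vertex_cyl_measurable)
  show "sets m = sigma_sets (inf_paths G) ?E" "sets m' = sigma_sets (inf_paths G) ?E"
    using gen conformal_sets m by auto
  show "Int_stable ?E"
  proof (rule Int_stableI)
    have cyl: "prefix_cyl xs \<inter> prefix_cyl ys \<in> {{}, prefix_cyl ys}" if "length xs \<le> length ys" for xs ys
    proof (cases "\<forall>i<length xs. xs ! i = ys ! i")
      case True
      with that have "prefix_cyl xs \<inter> prefix_cyl ys = prefix_cyl ys" by (auto simp: prefix_cyl_def)
      then show ?thesis by simp
    next
      case False
      with that have "prefix_cyl xs \<inter> prefix_cyl ys = {}" by (auto simp: prefix_cyl_def)
      then show ?thesis by simp
    qed
    have mem: "prefix_cyl zs \<inter> vertex_cyl G u \<in> ?E" if "zs \<in> lists (arcs G)" "u \<in> verts G" for zs u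
      using that by (intro insertI2 CollectI exI conjI) (rule refl)
    fix X Y assume "X \<in> ?E" "Y \<in> ?E"
    then consider "X \<inter> Y = {}" | xs ys v w where "X = prefix_cyl xs \<inter> vertex_cyl G v" "Y = prefix_cyl ys \<inter> vertex_cyl G w"
      "xs \<in> lists (arcs G)" "ys \<in> lists (arcs G)" "v \<in> verts G" "w \<in> verts G" by blast
    then show "X \<inter> Y \<in> ?E"
    proof cases
      case 2
      show ?thesis
      proof (cases "v = w")
        case True
        then have XY: "X \<inter> Y = (prefix_cyl xs \<inter> prefix_cyl ys) \<inter> vertex_cyl G v" using 2 by auto
        have "prefix_cyl xs \<inter> prefix_cyl ys \<in> {{}, prefix_cyl xs, prefix_cyl ys}"
          using cyl[of xs ys] cyl[of ys xs] by (cases "length xs \<le> length ys") (auto simp: Int_commute)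
        then consider "prefix_cyl xs \<inter> prefix_cyl ys = {}" | "prefix_cyl xs \<inter> prefix_cyl ys = prefix_cyl xs"
          | "prefix_cyl xs \<inter> prefix_cyl ys = prefix_cyl ys" by auto
        then show ?thesis
        proof cases
          case 1
          then show ?thesis unfolding XY by simp
        next
          case 2
          then show ?thesis unfolding XY using mem[OF \<open>xs \<in> lists (arcs G)\<close> \<open>v \<in> verts G\<close>] by simp
        next
          case 3
          then show ?thesis unfolding XY using mem[OF \<open>ys \<in> lists (arcs G)\<close> \<open>v \<in> verts G\<close>] by simp
        qed
      next
        case False
        then have "X \<inter> Y = {}" using 2 by (auto simp: vertex_cyl_def)
        then show ?thesis by simp
      qed
    qed simp
  qed
  have "emeasure m (prefix_cyl xs \<inter> vertex_cyl G v) = emeasure m' (prefix_cyl xs \<inter> vertex_cyl G v)"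
    if "xs \<in> lists (arcs G)" "v \<in> verts G" for xs v
    using that
  proof (induction xs arbitrary: v)
    case Nil
    then show ?case using eq by (simp add: prefix_cyl_def vertex_cyl_def Int_def)
  next
    case (Cons a xs)
    show ?case
    proof (cases "tail G a = v")
      case True
      let ?T = "{p \<in> inf_paths G. path_shift p \<in> prefix_cyl xs} \<inter> arrow_cyl G a"
      have "prefix_cyl (a # xs) \<inter> vertex_cyl G v = ?T"
        using True path_shift_in
        by (auto simp: prefix_cyl_def vertex_cyl_def arrow_cyl_def path_shift_apply nth_Cons less_Suc_eq_0_disj split: nat.splits)
      moreover have "emeasure m ?T = emeasure m' ?T"
        using Cons by (simp add: conformal_arrow[OF _ prefix_cyl_measurable] m)
      ultimately show ?thesis by simp
    next
      case False
      then have "prefix_cyl (a # xs) \<inter> vertex_cyl G v = {}" by (auto simp: prefix_cyl_def vertex_cyl_def)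
      then show ?thesis by simp
    qed
  qed
  then show "emeasure m X = emeasure m' X" if "X \<in> ?E" for X using that by auto
qed

lemma conformal_scale:
  assumes m: "conformal G F \<beta> m" and c: "c > 0"
  shows "conformal G F \<beta> (scale_measure (ennreal c) m)"
  using m c conformal_arrow[OF m] conformal_vertex_finite[OF m]
  by (intro conformalI) (auto simp: conformal_sets conformal_space conformal_nonzero space_scale_measure
      ennreal_mult_less_top mult_ac)

text \<open>For invariant \<open>S\<close> the intersection with \<open>S\<close> commutes with taking preimages under the shift.\<close>

lemma conformal_restrict:
  assumes m: "conformal G F \<beta> m" and S: "S \<in> sets (path_borel G)"
    and inv: "\<And>p. p \<in> inf_paths G \<Longrightarrow> path_shift p \<in> S \<longleftrightarrow> p \<in> S"
    and pos: "emeasure m S \<noteq> 0"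
  shows "conformal G F \<beta> (density m (indicator S))"
proof -
  have S': "S \<in> sets m" using S conformal_sets[OF m] by simp
  have em: "emeasure (density m (indicator S)) A = emeasure m (S \<inter> A)" if "A \<in> sets (path_borel G)" for A
    using that S' conformal_sets[OF m] by (simp add: emeasure_restricted)
  show ?thesis
  proof (rule conformalI)
    have top: "inf_paths G \<in> sets (path_borel G)" using sets.top[of "path_borel G"] by simp
    have "S \<inter> inf_paths G = S" using sets.sets_into_space[OF S] by auto
    then show "emeasure (density m (indicator S)) (inf_paths G) \<noteq> 0" using pos by (simp add: em top)
    fix v
    have "emeasure m (S \<inter> vertex_cyl G v) \<le> emeasure m (vertex_cyl G v)"
      using vertex_cyl_measurable by (intro emeasure_mono) (auto simp: conformal_sets[OF m])
    then show "emeasure (density m (indicator S)) (vertex_cyl G v) < \<infinity>"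
      using conformal_vertex_finite[OF m, of v] by (simp add: em vertex_cyl_measurable le_less_trans)
  next
    fix a T assume a: "a \<in> arcs G" and T: "T \<in> sets (path_borel G)"
    have "S \<inter> ({p \<in> inf_paths G. path_shift p \<in> T} \<inter> arrow_cyl G a)
        = {p \<in> inf_paths G. path_shift p \<in> S \<inter> T} \<inter> arrow_cyl G a"
      using inv by (auto simp: arrow_cyl_def)
    then show "emeasure (density m (indicator S)) ({p \<in> inf_paths G. path_shift p \<in> T} \<inter> arrow_cyl G a)
       = ennreal (wt a) * emeasure (density m (indicator S)) (T \<inter> vertex_cyl G (head G a))"
      using conformal_arrow[OF m sets.Int[OF S T] a]
      by (simp add: em sets.Int shift_preimage_measurable T arrow_cyl_measurable vertex_cyl_measurable Int_assoc)
  qed (auto simp: conformal_sets[OF m] conformal_space[OF m])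
qed

section \<open>Extremal measures and invariant sets\<close>

text \<open>If \<open>S\<close> has positive measure, the restriction to \<open>S\<close> is a conformal measure below \<open>m\<close>. It is then a
  positive multiple of \<open>m\<close>, but it vanishes on the complement of \<open>S\<close>.\<close>

lemma extremal_zero_one:
  assumes ext: "extremal_conformal G F \<beta> m" and S: "S \<in> sets (path_borel G)"
    and inv: "\<And>p. p \<in> inf_paths G \<Longrightarrow> path_shift p \<in> S \<longleftrightarrow> p \<in> S"
    and pos: "emeasure m S \<noteq> 0"
  shows "inf_paths G - S \<in> null_sets m"
proof -
  from ext have m: "conformal G F \<beta> m" by (simp add: extremal_conformal_def)
  let ?m' = "density m (indicator S)"
  have S': "S \<in> sets m" using S conformal_sets[OF m] by simp
  have em: "emeasure ?m' A = emeasure m (S \<inter> A)" if "A \<in> sets m" for A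
    using that S' by (simp add: emeasure_restricted)
  have "emeasure ?m' A \<le> emeasure m A" for A
  proof (cases "A \<in> sets m")
    case True
    then show ?thesis unfolding em[OF True] by (intro emeasure_mono) auto
  qed (simp add: emeasure_notin_sets)
  then have "?m' \<le> m" by (subst le_measure) (auto simp: le_fun_def)
  with ext conformal_restrict[OF m S inv pos] obtain c :: real
    where c: "c > 0" "?m' = scale_measure (ennreal c) m"
    unfolding extremal_conformal_def by blast
  have top: "inf_paths G - S \<in> sets m"
    using S' sets.compl_sets[OF S'] by (simp add: conformal_space[OF m])
  have "ennreal c * emeasure m (inf_paths G - S) = emeasure ?m' (inf_paths G - S)"
    unfolding c(2) by simp
  also have "\<dots> = emeasure m (S \<inter> (inf_paths G - S))" by (rule em[OF top])
  also have "\<dots> = 0" by (simp add: Diff_eq Int_left_commute)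
  finally show ?thesis using c(1) top by (auto simp: null_sets_def)
qed

lemma eventually_in_invariant:
  assumes "p \<in> inf_paths G"
  shows "path_shift p \<in> eventually_in D \<longleftrightarrow> p \<in> eventually_in D"
proof
  assume "path_shift p \<in> eventually_in D"
  then obtain N where "\<forall>i\<ge>N. tail G (p (Suc i)) \<in> D" by (auto simp: eventually_in_def path_shift_apply)
  then have "\<forall>i\<ge>Suc N. tail G (p i) \<in> D" by (metis Suc_le_D Suc_le_mono)
  with assms show "p \<in> eventually_in D" by (auto simp: eventually_in_def)
next
  assume "p \<in> eventually_in D"
  then show "path_shift p \<in> eventually_in D"
    using path_shift_in[OF assms] by (auto simp: eventually_in_def path_shift_apply intro: le_SucI)
qed

text \<open>Paths that stay in \<open>D\<close> from time \<open>N\<close> on are in \<open>D\<close> at each later time.\<close>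

lemma eventually_in_null:
  assumes m: "conformal G F \<beta> m"
    and lim: "\<And>v. v \<in> verts G \<Longrightarrow> (\<lambda>n. emeasure m {p \<in> vertex_cyl G v. tail G (p n) \<in> D}) \<longlonglongrightarrow> 0"
  shows "eventually_in D \<in> null_sets m"
proof -
  let ?B = "\<lambda>N. \<Inter>i\<in>{N..}. {p \<in> inf_paths G. tail G (p i) \<in> D}"
  have B: "?B N \<in> sets (path_borel G)" for N by (rule always_in_measurable)
  have "?B N \<in> null_sets m" for N
  proof (rule null_set_by_vertices[OF m B])
    fix v assume v: "v \<in> verts G"
    have "emeasure m (?B N \<inter> vertex_cyl G v) \<le> emeasure m {p \<in> vertex_cyl G v. tail G (p n) \<in> D}" if "n \<ge> N" for n
    proof (rule emeasure_mono)
      have "{p \<in> vertex_cyl G v. tail G (p n) \<in> D} = vertex_cyl G v \<inter> {p \<in> inf_paths G. tail G (p n) \<in> D}"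
        by (auto simp: vertex_cyl_def)
      then show "{p \<in> vertex_cyl G v. tail G (p n) \<in> D} \<in> sets m"
        using vertex_cyl_measurable vertex_measurable by (simp only: conformal_sets[OF m] sets.Int)
    qed (use that in auto)
    then have "emeasure m (?B N \<inter> vertex_cyl G v) \<le> 0"
      by (intro LIMSEQ_le_const[OF lim[OF v]]) auto
    then show "emeasure m (?B N \<inter> vertex_cyl G v) = 0" by simp
  qed
  then have "(\<Union>N. ?B N) \<in> null_sets m" by (intro null_sets_UN) 
  moreover have "(\<Union>N. ?B N) = eventually_in D" by (auto simp: eventually_in_def)
  ultimately show ?thesis by simp
qed

end

context transient_digraph begin

text \<open>The measures of the events that a path from \<open>v\<close> is at \<open>w\<close> at time \<open>n\<close> have the sum \<open>G(v,w) m (Z w)\<close>,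
  which is finite, so the Borel-Cantelli lemma applies.\<close>

lemma visits_finite:
  assumes m: "conformal G F \<beta> m" and w: "w \<in> verts G"
  shows "inf_paths G - eventually_in (- {w}) \<in> null_sets m"
proof (rule null_set_by_vertices[OF m])
  show "inf_paths G - eventually_in (- {w}) \<in> sets (path_borel G)"
    using sets.compl_sets[OF eventually_in_measurable] by simp
  fix v assume v: "v \<in> verts G"
  let ?A = "\<lambda>n. {p \<in> vertex_cyl G v. tail G (p n) \<in> {w}}"
  have A: "?A n \<in> sets m" for n
  proof -
    have "?A n = vertex_cyl G v \<inter> {p \<in> inf_paths G. tail G (p n) \<in> {w}}"
      by (auto simp: vertex_cyl_def)
    then show ?thesis using vertex_cyl_measurable vertex_measurable
      by (simp only: conformal_sets[OF m] sets.Int)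
  qed
  have "(\<lambda>u. if u \<in> {w} then emeasure m (vertex_cyl G u) else 0)
      = (\<lambda>u. emeasure m (vertex_cyl G w) * unit_vec w u)" by (auto simp: unit_vec_def)
  then have eA: "emeasure m (?A n) = emeasure m (vertex_cyl G w) * (mat_op ^^ n) (unit_vec w) v" for n
    unfolding conformal_visit[OF m] by (simp only: mat_op_pow_cmult)
  have "(\<Sum>n. emeasure m (?A n)) = emeasure m (vertex_cyl G w) * green v w"
    unfolding eA green_def by (rule ennreal_suminf_cmult)
  also have "\<dots> < \<infinity>"
    using conformal_vertex_finite[OF m, of w] green_finite[OF v w] by (simp add: ennreal_mult_less_top)
  finally have sum: "(\<Sum>n. emeasure m (?A n)) < \<infinity>" .
  have fin: "emeasure m (?A n) < \<infinity>" for n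
  proof -
    have "emeasure m (?A n) \<le> emeasure m (vertex_cyl G v)"
      using vertex_cyl_measurable by (intro emeasure_mono) (auto simp: conformal_sets[OF m])
    then show ?thesis using conformal_vertex_finite[OF m, of v] by (rule le_less_trans)
  qed
  have "summable (\<lambda>n. measure m (?A n))"
  proof (rule summable_suminf_not_top)
    have "ennreal (measure m (?A n)) = emeasure m (?A n)" for n
      using fin[of n] by (simp add: emeasure_eq_ennreal_measure less_top)
    then show "(\<Sum>n. ennreal (measure m (?A n))) \<noteq> top" using sum by simp
  qed simp
  from borel_cantelli_limsup1[OF A fin this] have "limsup ?A \<in> null_sets m" .
  moreover have "(inf_paths G - eventually_in (- {w})) \<inter> vertex_cyl G v \<subseteq> limsup ?A"
    by (auto simp: limsup_INF_SUP eventually_in_def vertex_cyl_def) 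
  ultimately show "emeasure m ((inf_paths G - eventually_in (- {w})) \<inter> vertex_cyl G v) = 0"
    by (meson emeasure_mono emeasure_eq_0 null_setsD1 null_setsD2)
qed

lemma non_wandering_null:
  assumes m: "conformal G F \<beta> m"
  shows "inf_paths G - wandering G \<in> null_sets m"
proof -
  have "inf_paths G - wandering G = (\<Union>w\<in>verts G. inf_paths G - eventually_in (- {w}))"
  proof (intro equalityI subsetI)
    fix p assume p: "p \<in> inf_paths G - wandering G"
    then obtain H where H: "finite H" "H \<subseteq> verts G" "\<not> (\<exists>N. \<forall>i\<ge>N. tail G (p i) \<notin> H)"
      by (auto simp: wandering_def)
    have "\<exists>w\<in>H. \<not> (\<forall>\<^sub>F i in sequentially. tail G (p i) \<noteq> w)"
    proof (rule ccontr)
      assume "\<not> ?thesis"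
      then have "\<forall>\<^sub>F i in sequentially. \<forall>w\<in>H. tail G (p i) \<noteq> w"
        using H(1) by (intro eventually_ball_finite) auto
      with H(3) show False by (auto simp: eventually_sequentially)
    qed
    with p H(2) show "p \<in> (\<Union>w\<in>verts G. inf_paths G - eventually_in (- {w}))"
      by (auto simp: eventually_sequentially eventually_in_def)
  next
    fix p assume "p \<in> (\<Union>w\<in>verts G. inf_paths G - eventually_in (- {w}))"
    then obtain w where w: "w \<in> verts G" "p \<in> inf_paths G" "p \<notin> eventually_in (- {w})" by auto
    then have "\<not> (\<exists>N. \<forall>i\<ge>N. tail G (p i) \<notin> {w})" by (auto simp: eventually_in_def)
    with w(1,2) show "p \<in> inf_paths G - wandering G"
      unfolding wandering_def by (auto dest!: spec[of _ "{w}"])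
  qed
  moreover have "(\<Union>w\<in>verts G. inf_paths G - eventually_in (- {w})) \<in> null_sets m"
    by (rule null_sets_UN'[OF countable_verts]) (rule visits_finite[OF m])
  ultimately show ?thesis by (simp only:)
qed

end

section \<open>Components and ends\<close>

context weighted_digraph begin

definition adjacent_outside :: "'v set \<Rightarrow> ('v \<times> 'v) set" where
  "adjacent_outside H = {(x, y). x \<notin> H \<and> y \<notin> H \<and>
     (\<exists>a\<in>arcs G. tail G a = x \<and> head G a = y \<or> tail G a = y \<and> head G a = x)}"

text \<open>Connected components of the complement of \<open>H\<close>, where arrows may be traversed backwards. If \<open>u\<close>
  belongs to \<open>H\<close>, the result is \<open>{u}\<close>.\<close>

definition component :: "'v set \<Rightarrow> 'v \<Rightarrow> 'v set" where
  "component H u = (adjacent_outside H)\<^sup>* `` {u}"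

text \<open>The component in which \<open>p\<close> finally stays. The quantifiers avoid a choice of time; for wandering
  \<open>p\<close> and finite \<open>H\<close> the components do not change any more from some time on.\<close>

definition end_component :: "'v set \<Rightarrow> (nat \<Rightarrow> 'a) \<Rightarrow> 'v set" where
  "end_component H p = {u. \<exists>N. \<forall>i\<ge>N. u \<in> component H (tail G (p i))}"

definition walk_outside :: "'v set \<Rightarrow> 'v \<Rightarrow> 'v \<Rightarrow> bool" where
  "walk_outside H x y \<longleftrightarrow> (\<exists>w. awalk x w y \<and> set (awalk_verts x w) \<inter> H = {})"

lemma component_refl: "u \<in> component H u"
  by (simp add: component_def)

lemma component_sym: "v \<in> component H u \<Longrightarrow> u \<in> component H v"
proof -
  have "sym ((adjacent_outside H)\<^sup>*)"
    by (rule sym_rtrancl) (auto simp: sym_def adjacent_outside_def)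
  then show "v \<in> component H u \<Longrightarrow> u \<in> component H v" by (auto simp: component_def dest: symD)
qed

lemma component_trans: "v \<in> component H u \<Longrightarrow> w \<in> component H v \<Longrightarrow> w \<in> component H u"
  by (auto simp: component_def)

lemma component_eq: "v \<in> component H u \<Longrightarrow> component H v = component H u"
  using component_trans component_sym by blast

lemma component_arc:
  "a \<in> arcs G \<Longrightarrow> tail G a \<notin> H \<Longrightarrow> head G a \<notin> H \<Longrightarrow> head G a \<in> component H (tail G a)"
  by (auto simp: component_def adjacent_outside_def)

lemma component_subset:
  assumes "u \<in> verts G - H" shows "component H u \<subseteq> verts G - H"
proof
  fix v assume "v \<in> component H u"
  then have "(u, v) \<in> (adjacent_outside H)\<^sup>*" by (simp add: component_def)
  then show "v \<in> verts G - H"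
    by (induction) (use assms in \<open>auto simp: adjacent_outside_def\<close>)
qed

lemma path_in_component:
  assumes p: "p \<in> inf_paths G" and out: "\<And>i. i \<ge> N \<Longrightarrow> tail G (p i) \<notin> H" and "N \<le> j"
  shows "tail G (p j) \<in> component H (tail G (p N))"
  using \<open>N \<le> j\<close>
proof (induction j rule: dec_induct)
  case (step j)
  have "head G (p j) \<in> component H (tail G (p j))"
    using out[of j] out[of "Suc j"] step.hyps p by (intro component_arc) (auto simp: inf_paths_arc inf_paths_step)
  with step.IH show ?case using p by (auto simp: inf_paths_step intro: component_trans)
qed (rule component_refl)

lemma end_component_tail:
  assumes p: "p \<in> inf_paths G" and out: "\<And>i. i \<ge> N \<Longrightarrow> tail G (p i) \<notin> H" and "N \<le> j"
  shows "component H (tail G (p j)) = end_component H p"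
proof -
  have eq: "component H (tail G (p i)) = component H (tail G (p j))" if "i \<ge> N" for i
    using path_in_component[OF p out] component_eq that \<open>N \<le> j\<close> by metis
  show ?thesis
  proof (intro equalityI subsetI)
    fix u assume "u \<in> component H (tail G (p j))"
    with eq show "u \<in> end_component H p" by (auto simp: end_component_def)
  next
    fix u assume "u \<in> end_component H p"
    then obtain M where M: "\<And>i. i \<ge> M \<Longrightarrow> u \<in> component H (tail G (p i))" by (auto simp: end_component_def)
    from M[of "max M N"] eq[of "max M N"] show "u \<in> component H (tail G (p j))" by auto
  qed
qed

lemma wandering_end_component:
  assumes p: "p \<in> wandering G" and H: "finite H" "H \<subseteq> verts G"
  shows "\<exists>N. \<forall>i\<ge>N. tail G (p i) \<notin> H \<and> component H (tail G (p i)) = end_component H p"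
proof -
  from p H obtain N where "\<And>i. i \<ge> N \<Longrightarrow> tail G (p i) \<notin> H" "p \<in> inf_paths G"
    unfolding wandering_def by blast
  then show ?thesis using end_component_tail by blast
qed

lemma end_component_subset:
  assumes "p \<in> wandering G" "finite H" "H \<subseteq> verts G"
  shows "end_component H p \<subseteq> verts G - H"
proof -
  from wandering_end_component[OF assms] obtain N
    where "tail G (p N) \<notin> H" "component H (tail G (p N)) = end_component H p" by blast
  moreover have "tail G (p N) \<in> verts G" using assms(1) by (auto simp: wandering_def inf_paths_vertex)
  ultimately show ?thesis using component_subset by blast
qed

text \<open>The vertices off \<open>H\<close> that are not in the component of \<open>p\<close> can only be left through \<open>H\<close>.\<close>

lemma end_component_closed:
  assumes p: "p \<in> wandering G" and H: "finite H" "H \<subseteq> verts G"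
    and a: "a \<in> arcs G" "tail G a \<in> verts G - H - end_component H p"
  shows "head G a \<in> (verts G - H - end_component H p) \<union> H"
proof (rule ccontr)
  assume "\<not> ?thesis"
  with a have h: "head G a \<in> end_component H p" "head G a \<notin> H" by auto
  from wandering_end_component[OF assms(1-3)] obtain u where u: "component H u = end_component H p" by blast
  from component_arc[OF a(1) _ h(2)] a(2) have "tail G a \<in> component H (head G a)"
    by (auto dest: component_sym)
  with h(1) have "tail G a \<in> end_component H p" unfolding u[symmetric] by (rule component_trans)
  with a(2) show False by auto
qed

lemma end_component_eq_component:
  assumes p: "p \<in> wandering G" and H: "finite H" "H \<subseteq> verts G"
    and ev: "p \<in> eventually_in (component H u)"
  shows "end_component H p = component H u"
proof -
  from wandering_end_component[OF p H] obtain N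
    where N: "\<And>i. i \<ge> N \<Longrightarrow> component H (tail G (p i)) = end_component H p" by blast
  from ev obtain M where M: "\<And>i. i \<ge> M \<Longrightarrow> tail G (p i) \<in> component H u" by (auto simp: eventually_in_def)
  show ?thesis using N[of "max N M"] component_eq[OF M[of "max N M"]] by simp
qed

lemma wandering_in_end_component:
  assumes p: "p \<in> wandering G" and H: "finite H" "H \<subseteq> verts G"
  shows "p \<in> eventually_in (end_component H p)"
proof -
  from wandering_end_component[OF p H] obtain N
    where N: "\<And>i. i \<ge> N \<Longrightarrow> component H (tail G (p i)) = end_component H p" by blast
  then have "\<forall>i\<ge>N. tail G (p i) \<in> end_component H p" using component_refl by blast
  then show ?thesis using p by (auto simp: eventually_in_def wandering_def)
qed

lemma walk_in_component:
  "awalk x w y \<Longrightarrow> set (awalk_verts x w) \<inter> H = {} \<Longrightarrow> y \<in> component H x"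
proof (induction w arbitrary: x)
  case Nil
  then show ?case by (auto simp: awalk_Nil_iff component_refl)
next
  case (Cons a w)
  then have a: "a \<in> arcs G" "tail G a = x" and w: "awalk (head G a) w y"
    by (auto simp: awalk_Cons_iff)
  have h: "head G a \<in> set (awalk_verts (head G a) w)" using hd_in_awalk_verts(1)[OF w] .
  with Cons.prems have "head G a \<in> component H x" using component_arc[OF a(1)] a(2) by auto
  moreover have "y \<in> component H (head G a)" using Cons.IH[OF w] Cons.prems(2) by auto
  ultimately show ?case by (rule component_trans)
qed

lemma leads_to_end_component:
  assumes "p \<in> wandering G" "q \<in> wandering G" "leads_to G p q" and H: "finite H" "H \<subseteq> verts G"
  shows "end_component H q = end_component H p"
proof -
  from wandering_end_component[OF assms(1) H] obtain N
    where N: "\<And>i. i \<ge> N \<Longrightarrow> component H (tail G (p i)) = end_component H p" by blast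
  from wandering_end_component[OF assms(2) H] obtain M
    where M: "\<And>i. i \<ge> M \<Longrightarrow> component H (tail G (q i)) = end_component H q" by blast
  have "finite H \<and> H \<subseteq> verts G" using H by blast
  with assms(3) obtain n k w where n: "n \<ge> max N M" "k \<ge> max N M"
    and w: "awalk (tail G (p n)) w (tail G (q k))" "set (awalk_verts (tail G (p n)) w) \<inter> H = {}"
    unfolding leads_to_def by metis
  from component_eq[OF walk_in_component[OF w]] N[of n] M[of k] n show ?thesis by simp
qed

lemma walk_outside_trans: "walk_outside H x y \<Longrightarrow> walk_outside H y z \<Longrightarrow> walk_outside H x z"
proof -
  assume "walk_outside H x y" "walk_outside H y z"
  then obtain v w where vw: "awalk x v y" "set (awalk_verts x v) \<inter> H = {}"
    "awalk y w z" "set (awalk_verts y w) \<inter> H = {}" by (auto simp: walk_outside_def)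
  then have "awalk x (v @ w) z" by (auto intro: awalk_appendI)
  moreover have "set (awalk_verts x (v @ w)) \<subseteq> set (awalk_verts x v) \<union> set (awalk_verts y w)"
    using awalk_verts_append[OF \<open>awalk x (v @ w) z\<close>] awalkE'[OF vw(1)] list.set_sel(2)[of "awalk_verts y w"]
    by auto
  ultimately show "walk_outside H x z" using vw unfolding walk_outside_def by blast
qed

lemma finite_reach: "finite {u. \<exists>w. awalk v w u \<and> length w \<le> k}"
proof (induction k arbitrary: v)
  case 0
  have "{u. \<exists>w. awalk v w u \<and> length w \<le> 0} \<subseteq> {v}" by (auto simp: awalk_Nil_iff)
  then show ?case by (rule finite_subset) simp
next
  case (Suc k)
  have "{u. \<exists>w. awalk v w u \<and> length w \<le> Suc k}
      \<subseteq> insert v (\<Union>a\<in>out_arcs G v. {u. \<exists>w. awalk (head G a) w u \<and> length w \<le> k})"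
  proof (intro subsetI, elim CollectE exE conjE)
    fix u w assume "awalk v w u" "length w \<le> Suc k"
    then show "u \<in> insert v (\<Union>a\<in>out_arcs G v. {u. \<exists>w. awalk (head G a) w u \<and> length w \<le> k})"
      by (cases w) (auto simp: awalk_Nil_iff awalk_Cons_iff)
  qed
  then show ?case by (rule finite_subset) (use Suc finite_out_arcs in auto)
qed

text \<open>Arrows can be reversed at the cost of a factor \<open>M\<close> in length. This is used to see that a vertex from
  which \<open>H\<close> can be reached by a short walk can also be reached from \<open>H\<close> by a short walk.\<close>

lemma walk_reverse:
  assumes M: "\<And>a. a \<in> arcs G \<Longrightarrow> \<exists>w. awalk (head G a) w (tail G a) \<and> length w \<le> M"
  shows "awalk x w y \<Longrightarrow> \<exists>w'. awalk y w' x \<and> length w' \<le> M * length w"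
proof (induction w arbitrary: x)
  case Nil
  then show ?case by (intro exI[of _ "[]"]) (auto simp: awalk_Nil_iff)
next
  case (Cons a w)
  then have a: "a \<in> arcs G" "tail G a = x" and w: "awalk (head G a) w y"
    by (auto simp: awalk_Cons_iff)
  from Cons.IH[OF w] obtain w' where "awalk y w' (head G a)" "length w' \<le> M * length w" by blast
  moreover from M[OF a(1)] a(2) obtain w'' where "awalk (head G a) w'' x" "length w'' \<le> M" by blast
  ultimately have "awalk y (w' @ w'') x" "length (w' @ w'') \<le> M * length (a # w)"
    by (auto intro: awalk_appendI)
  then show ?case by blast
qed

text \<open>An undirected walk that keeps away from a neighbourhood \<open>H'\<close> of \<open>H\<close> can be replaced by a directed
  walk that avoids \<open>H\<close>: each arrow \<open>a\<close> traversed backwards is replaced by a walk of length at most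
  \<open>M\<close> from its head to its tail. If that walk met \<open>H\<close> in \<open>h\<close>, then its first part, reversed, would be a walk
  from \<open>h\<close> to the head of \<open>a\<close> of length at most \<open>M * M\<close>. The neighbourhood is formed by walks
  starting in \<open>H\<close>, so that it is finite by row-finiteness.\<close>

lemma component_imp_walk_outside:
  assumes M: "\<And>a. a \<in> arcs G \<Longrightarrow> \<exists>w. awalk (head G a) w (tail G a) \<and> length w \<le> M"
    and H': "H' = H \<union> (\<Union>h\<in>H. {u. \<exists>w. awalk h w u \<and> length w \<le> M * M})"
    and x: "x \<in> verts G - H'" and y: "y \<in> component H' x"
  shows "walk_outside H x y"
proof -
  from y have "(x, y) \<in> (adjacent_outside H')\<^sup>*" by (simp add: component_def)
  then show ?thesis
  proof (induction)
    case base
    then show ?case using x H' unfolding walk_outside_def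
      by (intro exI[of _ "[]"]) (auto simp: awalk_Nil_iff)
  next
    case (step y z)
    then obtain a where a: "a \<in> arcs G" "y \<notin> H'" "z \<notin> H'"
      and or: "tail G a = y \<and> head G a = z \<or> tail G a = z \<and> head G a = y"
      by (auto simp: adjacent_outside_def)
    have "walk_outside H y z"
    proof (cases "tail G a = y \<and> head G a = z")
      case True
      then show ?thesis using a H' unfolding walk_outside_def
        by (intro exI[of _ "[a]"]) (auto simp: awalk_Cons_iff awalk_Nil_iff)
    next
      case False
      with or have b: "tail G a = z" "head G a = y" by auto
      from M[OF a(1)] b obtain w where w: "awalk y w z" "length w \<le> M" by auto
      have "set (awalk_verts y w) \<inter> H = {}"
      proof (rule ccontr)
        assume "set (awalk_verts y w) \<inter> H \<noteq> {}"
        then obtain h where h: "h \<in> set (awalk_verts y w)" "h \<in> H" by auto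
        from awalk_decomp[OF w(1) h(1)] obtain v v' where v: "w = v @ v'" "awalk y v h" by blast
        from walk_reverse[OF M v(2)] obtain v'' where v'': "awalk h v'' y" "length v'' \<le> M * length v"
          by blast
        have "length v'' \<le> M * M" using v'' v(1) w(2) by (auto intro: le_trans mult_le_mono2)
        with v'' h(2) a(2) show False unfolding H' by auto
      qed
      with w show ?thesis by (auto simp: walk_outside_def)
    qed
    with step.IH show ?case by (rule walk_outside_trans)
  qed
qed

lemma end_component_eq_leads_to:
  assumes au: "almost_undirected G" and p: "p \<in> wandering G" and q: "q \<in> wandering G"
    and eq: "\<And>H. finite H \<Longrightarrow> H \<subseteq> verts G \<Longrightarrow> end_component H p = end_component H q"
  shows "leads_to G p q"
  unfolding leads_to_def
proof (intro allI impI)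
  fix H N assume H: "finite H \<and> H \<subseteq> verts G"
  from au obtain M :: nat
    where M: "\<And>a. a \<in> arcs G \<Longrightarrow> \<exists>w. awalk (head G a) w (tail G a) \<and> length w \<le> M"
    unfolding almost_undirected_def by blast
  define H' where "H' = H \<union> (\<Union>h\<in>H. {u. \<exists>w. awalk h w u \<and> length w \<le> M * M})"
  have H'fin: "finite H'" "H' \<subseteq> verts G" unfolding H'_def using H finite_reach by auto
  from wandering_end_component[OF p H'fin] obtain K
    where K: "\<And>i. i \<ge> K \<Longrightarrow> tail G (p i) \<notin> H' \<and> component H' (tail G (p i)) = end_component H' p" by blast
  from wandering_end_component[OF q H'fin] obtain L
    where L: "\<And>i. i \<ge> L \<Longrightarrow> component H' (tail G (q i)) = end_component H' q" by blast
  define n where "n = max N (max K L)"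
  have "component H' (tail G (p n)) = component H' (tail G (q n))"
    using K[of n] L[of n] eq[OF H'fin] by (simp add: n_def)
  then have "tail G (q n) \<in> component H' (tail G (p n))" using component_refl by simp
  moreover have "tail G (p n) \<in> verts G - H'"
    using K[of n] p by (auto simp: n_def wandering_def inf_paths_vertex)
  ultimately have "walk_outside H (tail G (p n)) (tail G (q n))"
    using component_imp_walk_outside[OF M H'_def] by blast
  then show "\<exists>n\<^sub>1\<ge>N. \<exists>n\<^sub>2\<ge>N. \<exists>w. awalk (tail G (p n\<^sub>1)) w (tail G (q n\<^sub>2)) \<and>
      set (awalk_verts (tail G (p n\<^sub>1)) w) \<inter> H = {}"
    unfolding walk_outside_def by (intro exI[of _ n] conjI) (auto simp: n_def)
qed

definition finite_vertex_sets :: "'v set set" where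
  "finite_vertex_sets = {H. finite H \<and> H \<subseteq> verts G}"

lemma countable_finite_vertex_sets: "countable finite_vertex_sets"
  unfolding finite_vertex_sets_def by (rule countable_Collect_finite_subset[OF countable_verts])

text \<open>A directed walk that avoids \<open>H\<close> stays in one component, so equivalent paths have the same
  components; for the converse, a common component for a neighbourhood of \<open>H\<close> gives a directed
  walk that avoids \<open>H\<close>. The right hand side is a countable intersection of Borel sets, by \<open>countable_finite_vertex_sets\<close>, and membership
  in each of them depends on the tail of a path only.\<close>

lemma end_class_eq:
  assumes au: "almost_undirected G" and p: "p \<in> wandering G"
  shows "end_equiv G `` {p} = (\<Inter>H\<in>finite_vertex_sets. eventually_in (end_component H p))"
proof (intro equalityI subsetI INT_I)
  fix q H assume "q \<in> end_equiv G `` {p}" and "H \<in> finite_vertex_sets"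
  then have q: "q \<in> wandering G" "leads_to G p q" and H: "finite H" "H \<subseteq> verts G"
    by (auto simp: end_equiv_def finite_vertex_sets_def)
  show "q \<in> eventually_in (end_component H p)"
    using wandering_in_end_component[OF q(1) H] leads_to_end_component[OF p q H] by simp
next
  fix q assume "q \<in> (\<Inter>H\<in>finite_vertex_sets. eventually_in (end_component H p))"
  then have q: "q \<in> eventually_in (end_component H p)" if "finite H" "H \<subseteq> verts G" for H
    using that by (auto simp: finite_vertex_sets_def)
  have w: "q \<in> wandering G"
    unfolding wandering_def
  proof (intro CollectI conjI allI impI)
    show "q \<in> inf_paths G" using q[of "{}"] by (auto simp: eventually_in_def)
    fix H assume "finite H \<and> H \<subseteq> verts G"
    then show "\<exists>N. \<forall>i\<ge>N. tail G (q i) \<notin> H"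
      using q[of H] end_component_subset[OF p, of H] unfolding eventually_in_def by blast
  qed
  have "end_component H q = end_component H p" if H: "finite H" "H \<subseteq> verts G" for H
  proof -
    from wandering_end_component[OF p H] obtain u where "end_component H p = component H u" by blast
    with end_component_eq_component[OF w H] q[OF H] show ?thesis by simp
  qed
  with w p end_component_eq_leads_to[OF au] show "q \<in> end_equiv G `` {p}"
    by (auto simp: end_equiv_def)
qed

lemma end_class_disjoint:
  assumes au: "almost_undirected G" and E: "E \<in> end_space G" "E' \<in> end_space G" and r: "r \<in> E" "r \<in> E'"
  shows "E = E'"
proof -
  have *: "E = end_equiv G `` {r}" if "E \<in> end_space G" "r \<in> E" for E
  proof -
    from that obtain p where p: "p \<in> wandering G" "E = end_equiv G `` {p}"
      unfolding end_space_def by (auto elim: quotientE)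
    with that(2) have r: "r \<in> wandering G" "leads_to G p r" by (auto simp: end_equiv_def)
    then have "end_component H r = end_component H p" if "H \<in> finite_vertex_sets" for H
      using leads_to_end_component[OF p(1) r] that by (auto simp: finite_vertex_sets_def)
    then show ?thesis unfolding p(2) end_class_eq[OF au p(1)] end_class_eq[OF au r(1)] by simp
  qed
  show ?thesis using *[OF E(1) r(1)] *[OF E(2) r(2)] by simp
qed

lemma end_class_compl:
  assumes au: "almost_undirected G" and p: "p \<in> wandering G"
  shows "inf_paths G - end_equiv G `` {p} = (\<Union>H\<in>finite_vertex_sets. inf_paths G - eventually_in (end_component H p))"
  by (auto simp: end_class_eq[OF assms])

end

context transient_digraph begin

text \<open>Countably many invariant sets cover almost all of path space, so one of them has positive measure,
  and by the zero-one law full measure.\<close>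

lemma extremal_component:
  assumes ext: "extremal_conformal G F \<beta> m" and H: "finite H" "H \<subseteq> verts G"
  shows "\<exists>u\<in>verts G - H. inf_paths G - eventually_in (component H u) \<in> null_sets m"
proof (rule ccontr)
  assume not: "\<not> ?thesis"
  from ext have m: "conformal G F \<beta> m" by (simp add: extremal_conformal_def)
  have "eventually_in (component H u) \<in> null_sets m" if "u \<in> verts G - H" for u
  proof (rule ccontr)
    assume "eventually_in (component H u) \<notin> null_sets m"
    then have "emeasure m (eventually_in (component H u)) \<noteq> 0"
      using eventually_in_measurable by (auto simp: null_sets_def conformal_sets[OF m])
    from extremal_zero_one[OF ext eventually_in_measurable eventually_in_invariant this] not that
    show False by auto
  qed
  then have "(\<Union>u\<in>verts G - H. eventually_in (component H u)) \<in> null_sets m"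
    using countable_verts by (intro null_sets_UN') auto
  from null_sets.Un[OF this non_wandering_null[OF m]]
  have "(\<Union>u\<in>verts G - H. eventually_in (component H u)) \<union> (inf_paths G - wandering G) \<in> null_sets m" .
  moreover have "inf_paths G \<subseteq> (\<Union>u\<in>verts G - H. eventually_in (component H u)) \<union> (inf_paths G - wandering G)"
  proof
    fix p assume p: "p \<in> inf_paths G"
    show "p \<in> (\<Union>u\<in>verts G - H. eventually_in (component H u)) \<union> (inf_paths G - wandering G)"
    proof (cases "p \<in> wandering G")
      case True
      from wandering_end_component[OF True H] obtain N
        where N: "tail G (p N) \<notin> H" "component H (tail G (p N)) = end_component H p" by blast
      have "p \<in> eventually_in (component H (tail G (p N)))"
        unfolding N(2) by (rule wandering_in_end_component[OF True H])
      with N(1) show ?thesis using inf_paths_vertex[OF p] by blast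
    qed (use p in auto)
  qed
  ultimately have "emeasure m (inf_paths G) = 0" by (meson emeasure_eq_0 null_setsD1 null_setsD2)
  with conformal_nonzero[OF m] show False by simp
qed

lemma extremal_concentrated:
  assumes au: "almost_undirected G" and ext: "extremal_conformal G F \<beta> m"
  shows "\<exists>E\<in>end_space G. concentrated_on m E"
proof -
  from ext have m: "conformal G F \<beta> m" by (simp add: extremal_conformal_def)
  from extremal_component[OF ext] obtain c where c:
    "\<And>H. H \<in> finite_vertex_sets \<Longrightarrow> inf_paths G - eventually_in (component H (c H)) \<in> null_sets m"
    unfolding finite_vertex_sets_def by (metis (lifting) mem_Collect_eq)
  have null: "(\<Union>H\<in>finite_vertex_sets. inf_paths G - eventually_in (component H (c H))) \<in> null_sets m" (is "?N \<in> _")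
    by (intro null_sets_UN' countable_finite_vertex_sets c)
  have "\<not> inf_paths G \<subseteq> ?N \<union> (inf_paths G - wandering G)"
  proof
    assume "inf_paths G \<subseteq> ?N \<union> (inf_paths G - wandering G)"
    with null_sets.Un[OF null non_wandering_null[OF m]] have "emeasure m (inf_paths G) = 0"
      by (meson emeasure_eq_0 null_setsD1 null_setsD2)
    with conformal_nonzero[OF m] show False by simp
  qed
  then obtain p where p: "p \<in> wandering G" "p \<notin> ?N" by auto
  have "end_component H p = component H (c H)" if "H \<in> finite_vertex_sets" for H
    using that p by (intro end_component_eq_component) (auto simp: finite_vertex_sets_def wandering_def)
  then have "inf_paths G - end_equiv G `` {p} = ?N" by (simp add: end_class_compl[OF au p(1)])
  with null have "concentrated_on m (end_equiv G `` {p})"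
    by (simp add: concentrated_on_def conformal_space[OF m])
  moreover have "end_equiv G `` {p} \<in> end_space G" unfolding end_space_def using p(1) by (rule quotientI)
  ultimately show ?thesis by blast
qed

lemma concentrated_unique:
  assumes au: "almost_undirected G" and m: "conformal G F \<beta> m"
    and E: "E \<in> end_space G" "E' \<in> end_space G" "concentrated_on m E" "concentrated_on m E'"
  shows "E = E'"
proof (rule ccontr)
  assume "E \<noteq> E'"
  then have "inf_paths G \<subseteq> (inf_paths G - E) \<union> (inf_paths G - E')"
    using end_class_disjoint[OF au E(1,2)] by blast
  moreover have "(inf_paths G - E) \<union> (inf_paths G - E') \<in> null_sets m"
    using E(3,4) unfolding concentrated_on_def conformal_space[OF m] by (rule null_sets.Un)
  ultimately have "emeasure m (inf_paths G) = 0" by (meson emeasure_eq_0 null_setsD1 null_setsD2)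
  with conformal_nonzero[OF m] show False by simp
qed

text \<open>A wandering path that does not finally stay in the component of \<open>p\<close> finally stays in another one,
  and this is a part of the set in the hypothesis.\<close>

lemma concentrated_on_endI:
  assumes au: "almost_undirected G" and m: "conformal G F \<beta> m" and p: "p \<in> wandering G"
    and null: "\<And>H. H \<in> finite_vertex_sets \<Longrightarrow> eventually_in (verts G - H - end_component H p) \<in> null_sets m"
  shows "concentrated_on m (end_equiv G `` {p})"
proof -
  let ?D = "\<lambda>H. verts G - H - end_component H p"
  have "inf_paths G - eventually_in (end_component H p) \<in> null_sets m" if H: "H \<in> finite_vertex_sets" for H
  proof (rule null_sets_subset[OF null_sets.Un[OF null[OF H] non_wandering_null[OF m]]])
    show "inf_paths G - eventually_in (end_component H p) \<in> sets m"
      using sets.compl_sets[OF eventually_in_measurable] by (simp add: conformal_sets[OF m])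
    show "inf_paths G - eventually_in (end_component H p) \<subseteq> eventually_in (?D H) \<union> (inf_paths G - wandering G)"
    proof
      fix q assume q: "q \<in> inf_paths G - eventually_in (end_component H p)"
      have "q \<in> eventually_in (?D H)" if w: "q \<in> wandering G"
      proof -
        from H have H': "finite H" "H \<subseteq> verts G" by (auto simp: finite_vertex_sets_def)
        note in_own = wandering_in_end_component[OF w H']
        from wandering_end_component[OF p H'] obtain u where u: "component H u = end_component H p" by blast
        from wandering_end_component[OF w H'] obtain v where v: "component H v = end_component H q" by blast
        have "end_component H q \<inter> end_component H p = {}"
        proof (rule ccontr)
          assume "end_component H q \<inter> end_component H p \<noteq> {}"
          then obtain x where "x \<in> component H u" "x \<in> component H v" unfolding u v by auto
          then have "end_component H q = end_component H p" unfolding u[symmetric] v[symmetric]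
            using component_eq by blast
          with in_own q show False by auto
        qed
        then have "end_component H q \<subseteq> ?D H" using end_component_subset[OF w H'] by auto
        with in_own show ?thesis by (auto simp: eventually_in_def)
      qed
      with q show "q \<in> eventually_in (?D H) \<union> (inf_paths G - wandering G)" by auto
    qed
  qed
  then have "(\<Union>H\<in>finite_vertex_sets. inf_paths G - eventually_in (end_component H p)) \<in> null_sets m"
    by (intro null_sets_UN' countable_finite_vertex_sets)
  then show ?thesis by (simp add: concentrated_on_def conformal_space[OF m] end_class_compl[OF au p])
qed

end

section \<open>From harmonic functions to conformal measures\<close>

text \<open>Infinite paths from \<open>v\<close> are coded by points of the interval \<open>[0, \<psi> v)\<close>. Since \<open>\<psi>\<close> is harmonic, this
  interval can be divided into cells, one for each arrow \<open>a\<close> that leaves \<open>v\<close>, of length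
  \<open>wt a * \<psi> (head a)\<close>. The point \<open>y\<close> selects the arrow of its cell, the cell is stretched to
  \<open>[0, \<psi> (head a))\<close>, and one continues with the image of \<open>y\<close>. The measure wanted is the
  image of Lebesgue measure: conformality says precisely that the stretching divides lengths by
  \<open>wt a\<close>.\<close>

locale harmonic_coding = weighted_digraph G F \<beta>
  for G :: "('v, 'a) pre_digraph" and F \<beta> +
  fixes \<psi> :: "'v \<Rightarrow> real"
  assumes nonneg: "0 \<le> \<psi> v"
    and harmonic: "(\<Sum>a\<in>out_arcs G v. wt a * \<psi> (head G a)) = \<psi> v"
begin

text \<open>The cells of the arrows that leave \<open>v\<close> are arranged in the order of a fixed enumeration of the arrows.\<close>

definition start :: "'v \<Rightarrow> nat \<Rightarrow> real" where
  "start v n = (\<Sum>a\<in>{a \<in> out_arcs G v. to_nat_on (arcs G) a < n}. wt a * \<psi> (head G a))"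

definition cell :: "'a \<Rightarrow> real set" where
  "cell a = {start (tail G a) (to_nat_on (arcs G) a) ..<
             start (tail G a) (to_nat_on (arcs G) a) + wt a * \<psi> (head G a)}"

definition select :: "'v \<Rightarrow> real \<Rightarrow> 'a" where
  "select v y = (SOME a. a \<in> out_arcs G v \<and> y \<in> cell a)"

definition rescale :: "'a \<Rightarrow> real \<Rightarrow> real" where
  "rescale a y = (y - start (tail G a) (to_nat_on (arcs G) a)) / wt a"

primrec coded_arrow :: "nat \<Rightarrow> 'v \<Rightarrow> real \<Rightarrow> 'a" where
  "coded_arrow 0 v y = select v y"
| "coded_arrow (Suc n) v y = coded_arrow n (head G (select v y)) (rescale (select v y) y)"

definition coded_path :: "'v \<Rightarrow> real \<Rightarrow> nat \<Rightarrow> 'a" where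
  "coded_path v y = (\<lambda>n. coded_arrow n v y)"

definition coded_mass :: "'v \<Rightarrow> (nat \<Rightarrow> 'a) set \<Rightarrow> ennreal" where
  "coded_mass v S = emeasure lborel {y \<in> {0..<\<psi> v}. coded_path v y \<in> S}"

text \<open>The total mass can be infinite, but there are only countably many starting vertices.\<close>

definition coded_measure :: "(nat \<Rightarrow> 'a) measure" where
  "coded_measure = measure_of (inf_paths G) (sets (path_borel G))
     (\<lambda>S. \<integral>\<^sup>+v. coded_mass v S \<partial>count_space (verts G))"

lemma len_nonneg: "0 \<le> wt a * \<psi> (head G a)"
  using wt_pos[of a] nonneg by simp

lemma idx_inj: "a \<in> arcs G \<Longrightarrow> b \<in> arcs G \<Longrightarrow> to_nat_on (arcs G) a = to_nat_on (arcs G) b \<Longrightarrow> a = b"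
  using inj_on_to_nat_on[OF countable_arcs] by (auto dest: inj_onD)

lemma start_mono: "m \<le> n \<Longrightarrow> start v m \<le> start v n"
  unfolding start_def using finite_out_arcs[of v] len_nonneg
  by (intro sum_mono2) (auto simp del: in_out_arcs_conv)

lemma start_0: "start v 0 = 0"
  by (simp add: start_def)

lemma start_le: "start v n \<le> \<psi> v"
  unfolding start_def harmonic[of v, symmetric] using finite_out_arcs len_nonneg by (intro sum_mono2) auto

lemma start_Suc:
  assumes "a \<in> out_arcs G v"
  shows "start v (Suc (to_nat_on (arcs G) a)) = start v (to_nat_on (arcs G) a) + wt a * \<psi> (head G a)"
proof -
  have "{b \<in> out_arcs G v. to_nat_on (arcs G) b < Suc (to_nat_on (arcs G) a)}
      = insert a {b \<in> out_arcs G v. to_nat_on (arcs G) b < to_nat_on (arcs G) a}"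
    using assms idx_inj by (auto simp: less_Suc_eq)
  then show ?thesis unfolding start_def using finite_out_arcs[of v]
    by (simp del: in_out_arcs_conv)
qed

lemma cell_eq: "a \<in> out_arcs G v \<Longrightarrow>
    cell a = {start v (to_nat_on (arcs G) a) ..< start v (Suc (to_nat_on (arcs G) a))}"
  using start_Suc[of a v] by (simp add: cell_def)

lemma cells_disjoint:
  assumes "a \<in> out_arcs G v" "b \<in> out_arcs G v" "y \<in> cell a" "y \<in> cell b"
  shows "a = b"
proof (rule ccontr)
  assume "a \<noteq> b"
  then have "to_nat_on (arcs G) a \<noteq> to_nat_on (arcs G) b" using assms(1,2) idx_inj by auto
  then consider "Suc (to_nat_on (arcs G) a) \<le> to_nat_on (arcs G) b"
    | "Suc (to_nat_on (arcs G) b) \<le> to_nat_on (arcs G) a" by linarith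
  then show False
    by cases (use assms(3,4) start_mono[of _ _ v] in \<open>force simp: cell_eq[OF assms(1)] cell_eq[OF assms(2)]\<close>)+
qed

text \<open>The cell of \<open>y\<close> belongs to the first index at which the partial sums of the lengths exceed \<open>y\<close>.\<close>

lemma cells_cover:
  assumes y: "y \<in> {0..<\<psi> v}" shows "\<exists>a\<in>out_arcs G v. y \<in> cell a"
proof -
  obtain M where M: "to_nat_on (arcs G) ` out_arcs G v \<subseteq> {..<M}"
    using finite_nat_iff_bounded[of "to_nat_on (arcs G) ` out_arcs G v"] finite_out_arcs[of v] by blast
  then have "{a \<in> out_arcs G v. to_nat_on (arcs G) a < M} = out_arcs G v" by auto
  then have "y < start v M" using y harmonic[of v] unfolding start_def by (simp del: in_out_arcs_conv)
  define n where "n = (LEAST n. y < start v n)"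
  have n: "y < start v n" unfolding n_def by (rule LeastI) fact
  have "n \<noteq> 0" using n y start_0[of v] by (intro notI) simp
  then obtain k where k: "n = Suc k" by (cases n) auto
  have "\<not> y < start v k" using not_less_Least[of k "\<lambda>n. y < start v n"] unfolding n_def[symmetric] k by simp
  have "\<exists>a\<in>out_arcs G v. to_nat_on (arcs G) a = k"
  proof (rule ccontr)
    assume "\<not> ?thesis"
    then have "{a \<in> out_arcs G v. to_nat_on (arcs G) a < Suc k} = {a \<in> out_arcs G v. to_nat_on (arcs G) a < k}"
      by (auto simp: less_Suc_eq)
    with n k \<open>\<not> y < start v k\<close> show False by (simp add: start_def)
  qed
  then obtain a where "a \<in> out_arcs G v" "to_nat_on (arcs G) a = k" by auto
  with n k \<open>\<not> y < start v k\<close> show ?thesis by (auto simp: cell_eq[of a v] intro!: bexI[of _ a])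
qed

lemma select_eq: "a \<in> out_arcs G v \<Longrightarrow> y \<in> cell a \<Longrightarrow> select v y = a"
  unfolding select_def by (rule some_equality) (auto intro: cells_disjoint)

lemma rescale_in_iff: "rescale a y \<in> {0..<\<psi> (head G a)} \<longleftrightarrow> y \<in> cell a"
  using wt_pos[of a] by (auto simp: rescale_def cell_def field_simps)

lemma cell_subset: "a \<in> out_arcs G v \<Longrightarrow> cell a \<subseteq> {0..<\<psi> v}"
  using start_mono[of 0 "to_nat_on (arcs G) a" v] start_le[of v "Suc (to_nat_on (arcs G) a)"]
  by (auto simp: cell_eq[of a v] start_0 simp del: in_out_arcs_conv)

lemma coded_path_step:
  "a \<in> out_arcs G v \<Longrightarrow> y \<in> cell a \<Longrightarrow>
    coded_path v y = case_nat a (coded_path (head G a) (rescale a y))"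
  by (auto simp: coded_path_def fun_eq_iff select_eq split: nat.splits)

lemma coded_path_in:
  assumes "y \<in> {0..<\<psi> v}"
  shows "coded_path v y \<in> vertex_cyl G v"
proof -
  have "coded_arrow n v y \<in> arcs G \<and> head G (coded_arrow n v y) = tail G (coded_arrow (Suc n) v y)
      \<and> tail G (coded_arrow 0 v y) = v" for n
    using assms
  proof (induction n arbitrary: v y)
    case 0
    from cells_cover[OF 0] obtain a where a: "a \<in> out_arcs G v" "y \<in> cell a" by blast
    then have "rescale a y \<in> {0..<\<psi> (head G a)}" by (simp only: rescale_in_iff)
    from cells_cover[OF this] obtain b where "b \<in> out_arcs G (head G a)" "rescale a y \<in> cell b" by blast
    with a show ?case by (simp add: select_eq)
  next
    case (Suc n)
    from cells_cover[OF Suc.prems] obtain a where a: "a \<in> out_arcs G v" "y \<in> cell a" by blast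
    then have "rescale a y \<in> {0..<\<psi> (head G a)}" by (simp only: rescale_in_iff)
    from Suc.IH[OF this] a show ?case by (simp add: select_eq)
  qed
  then show ?thesis unfolding coded_path_def vertex_cyl_def inf_paths_def by blast
qed

lemma coded_arrow_measurable: "{y \<in> {0..<\<psi> v}. coded_arrow n v y = b} \<in> sets borel"
proof (induction n arbitrary: v)
  case 0
  have "{y \<in> {0..<\<psi> v}. coded_arrow 0 v y = b} = (\<Union>a\<in>out_arcs G v \<inter> {b}. cell a)"
    using cells_cover[of _ v] cell_subset[of _ v] by (force simp: select_eq)
  also have "\<dots> \<in> sets borel" by (auto simp: cell_def)
  finally show ?case .
next
  case (Suc n)
  let ?A = "\<lambda>a. {z \<in> {0..<\<psi> (head G a)}. coded_arrow n (head G a) z = b}"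
  have "{y \<in> {0..<\<psi> v}. coded_arrow (Suc n) v y = b} = (\<Union>a\<in>out_arcs G v. rescale a -` ?A a)"
  proof (intro equalityI subsetI)
    fix y assume y: "y \<in> {y \<in> {0..<\<psi> v}. coded_arrow (Suc n) v y = b}"
    with cells_cover[of y v] obtain a where a: "a \<in> out_arcs G v" "y \<in> cell a" by blast
    with y rescale_in_iff[of a y] show "y \<in> (\<Union>a\<in>out_arcs G v. rescale a -` ?A a)"
      by (intro UN_I[of a]) (auto simp: select_eq)
  next
    fix y assume "y \<in> (\<Union>a\<in>out_arcs G v. rescale a -` ?A a)"
    then obtain a where a: "a \<in> out_arcs G v" "rescale a y \<in> ?A a" by blast
    then have "y \<in> cell a" using rescale_in_iff[of a y] by blast
    with a cell_subset[of a v] show "y \<in> {y \<in> {0..<\<psi> v}. coded_arrow (Suc n) v y = b}"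
      by (auto simp: select_eq)
  qed
  also have "\<dots> \<in> sets borel"
  proof (intro sets.finite_UN finite_out_arcs)
    fix a
    have "rescale a \<in> borel_measurable borel" unfolding rescale_def by measurable
    from measurable_sets[OF this Suc[of "head G a"]] show "rescale a -` ?A a \<in> sets borel" by simp
  qed
  finally show ?case .
qed

lemma coded_set_measurable:
  assumes "S \<in> sets (path_borel G)"
  shows "{y \<in> {0..<\<psi> v}. coded_path v y \<in> S} \<in> sets borel"
proof -
  have "coded_path v \<in> measurable (restrict_space borel {0..<\<psi> v}) (path_borel G)"
  proof (rule measurable_path_borelI)
    show "coded_path v \<in> space (restrict_space borel {0..<\<psi> v}) \<rightarrow> inf_paths G"
      using coded_path_in[of _ v] by (auto simp: space_restrict_space vertex_cyl_def)
    fix n b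
    have "{x \<in> space (restrict_space borel {0..<\<psi> v}). coded_path v x n = b} = {y \<in> {0..<\<psi> v}. coded_arrow n v y = b}"
      by (auto simp: coded_path_def space_restrict_space)
    then show "{x \<in> space (restrict_space borel {0..<\<psi> v}). coded_path v x n = b} \<in> sets (restrict_space borel {0..<\<psi> v})"
      using sets_restrict_space_iff[of "{0..<\<psi> v}" borel "{y \<in> {0..<\<psi> v}. coded_arrow n v y = b}"]
        coded_arrow_measurable[of v n b] by (simp add: Collect_mono_iff subset_eq)
  qed
  from measurable_sets[OF this assms]
  have "coded_path v -` S \<inter> {0..<\<psi> v} \<in> sets (restrict_space borel {0..<\<psi> v})"
    by (simp add: space_restrict_space)
  then have "coded_path v -` S \<inter> {0..<\<psi> v} \<in> sets borel"
    by (rule sets_restrict_space_iff[THEN iffD1, THEN conjunct2, rotated]) simp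
  also have "coded_path v -` S \<inter> {0..<\<psi> v} = {y \<in> {0..<\<psi> v}. coded_path v y \<in> S}" by auto
  finally show ?thesis .
qed

lemma coded_mass_measure:
  "coded_mass v S = emeasure (distr (restrict_space lborel {0..<\<psi> v}) (path_borel G) (coded_path v)) S"
  if "S \<in> sets (path_borel G)"
proof -
  have "coded_path v \<in> measurable (restrict_space lborel {0..<\<psi> v}) (path_borel G)"
  proof (rule measurableI)
    show "coded_path v x \<in> space (path_borel G)" if "x \<in> space (restrict_space lborel {0..<\<psi> v})" for x
      using coded_path_in[of x v] that by (auto simp: space_restrict_space vertex_cyl_def)
    show "coded_path v -` A \<inter> space (restrict_space lborel {0..<\<psi> v}) \<in> sets (restrict_space lborel {0..<\<psi> v})"
      if "A \<in> sets (path_borel G)" for A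
      using coded_set_measurable[OF that, of v]
      by (auto simp: sets_restrict_space_iff space_restrict_space vimage_def Int_def conj_commute)
  qed
  then have "emeasure (distr (restrict_space lborel {0..<\<psi> v}) (path_borel G) (coded_path v)) S
      = emeasure (restrict_space lborel {0..<\<psi> v}) (coded_path v -` S \<inter> {0..<\<psi> v})"
    using that by (simp add: emeasure_distr space_restrict_space)
  also have "\<dots> = emeasure lborel (coded_path v -` S \<inter> {0..<\<psi> v})"
    by (rule emeasure_restrict_space) auto
  also have "coded_path v -` S \<inter> {0..<\<psi> v} = {y \<in> {0..<\<psi> v}. coded_path v y \<in> S}" by auto
  finally show ?thesis by (simp add: coded_mass_def)
qed

lemma sets_coded_measure: "sets coded_measure = sets (path_borel G)"
  and space_coded_measure: "space coded_measure = inf_paths G"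
proof -
  have sub: "sets (path_borel G) \<subseteq> Pow (inf_paths G)"
    using sets.space_closed[of "path_borel G"] by simp
  show "sets coded_measure = sets (path_borel G)"
    unfolding coded_measure_def sets_measure_of[OF sub]
    using sets.sigma_sets_eq[of "path_borel G"] by (simp only: space_path_borel)
  show "space coded_measure = inf_paths G"
    unfolding coded_measure_def by (rule space_measure_of[OF sub])
qed

lemma emeasure_coded_measure:
  assumes "S \<in> sets (path_borel G)"
  shows "emeasure coded_measure S = (\<integral>\<^sup>+v. coded_mass v S \<partial>count_space (verts G))"
  unfolding coded_measure_def
proof (rule emeasure_measure_of_sigma)
  show "sigma_algebra (inf_paths G) (sets (path_borel G))"
    using sets.sigma_algebra_axioms[of "path_borel G"] by simp
  show "positive (sets (path_borel G)) (\<lambda>S. \<integral>\<^sup>+v. coded_mass v S \<partial>count_space (verts G))"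
    by (simp add: positive_def coded_mass_def)
  show "countably_additive (sets (path_borel G)) (\<lambda>S. \<integral>\<^sup>+v. coded_mass v S \<partial>count_space (verts G))"
  proof (rule countably_additiveI)
    fix A :: "nat \<Rightarrow> (nat \<Rightarrow> 'a) set"
    assume A: "range A \<subseteq> sets (path_borel G)" "disjoint_family A" "(\<Union>i. A i) \<in> sets (path_borel G)"
    have "(\<Sum>i. coded_mass v (A i)) = coded_mass v (\<Union>i. A i)" for v
      using A by (simp add: coded_mass_measure range_subsetD suminf_emeasure)
    then show "(\<Sum>i. \<integral>\<^sup>+v. coded_mass v (A i) \<partial>count_space (verts G))
        = (\<integral>\<^sup>+v. coded_mass v (\<Union>i. A i) \<partial>count_space (verts G))"
      by (subst nn_integral_suminf[symmetric]) auto
  qed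
qed (fact assms)

text \<open>For sets of paths with the same first vertex only one summand contributes.\<close>

lemma emeasure_coded_measure_vertex:
  assumes S: "S \<in> sets (path_borel G)" "S \<subseteq> vertex_cyl G v" and v: "v \<in> verts G"
  shows "emeasure coded_measure S = coded_mass v S"
proof -
  have *: "coded_mass u S = coded_mass v S * indicator {v} u" for u
  proof (cases "u = v")
    case False
    then have "{y \<in> {0..<\<psi> u}. coded_path u y \<in> S} = {}"
      using S(2) coded_path_in[of _ u] by (force simp: vertex_cyl_def)
    with False show ?thesis by (simp only: coded_mass_def) simp
  qed simp
  have "emeasure coded_measure S = (\<integral>\<^sup>+u. coded_mass v S * indicator {v} u \<partial>count_space (verts G))"
    unfolding emeasure_coded_measure[OF S(1)] by (intro nn_integral_cong) (rule *)
  also have "\<dots> = coded_mass v S"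
    using v by (subst nn_integral_cmult_indicator) auto
  finally show ?thesis .
qed

lemma coded_measure_vertex: "emeasure coded_measure (vertex_cyl G v) = ennreal (\<psi> v)"
proof (cases "v \<in> verts G")
  case True
  have "{y \<in> {0..<\<psi> v}. coded_path v y \<in> vertex_cyl G v} = {0..<\<psi> v}"
  proof (intro equalityI subsetI)
    fix y assume y: "y \<in> {0..<\<psi> v}"
    from y coded_path_in[OF y] show "y \<in> {y \<in> {0..<\<psi> v}. coded_path v y \<in> vertex_cyl G v}" by (simp only: mem_Collect_eq simp_thms)
  qed simp
  then have "coded_mass v (vertex_cyl G v) = ennreal (\<psi> v)"
    using nonneg[of v] by (simp only: coded_mass_def) simp
  with True show ?thesis
    using emeasure_coded_measure_vertex[OF vertex_cyl_measurable order_refl, of v] by simp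
next
  case False
  then have "out_arcs G v = {}" by (rule out_arcs_outside)
  with harmonic[of v] have "\<psi> v = 0" by (metis sum.empty)
  with False show ?thesis by (simp add: vertex_cyl_outside)
qed

lemma emeasure_lborel_rescale:
  assumes A: "A \<in> sets borel"
  shows "emeasure lborel (rescale a -` A) = ennreal (wt a) * emeasure lborel A"
proof -
  let ?t = "- start (tail G a) (to_nat_on (arcs G) a) / wt a"
  have r: "rescale a y = ?t + (1 / wt a) * y" for y by (simp add: rescale_def diff_divide_distrib)
  have "rescale a \<in> borel_measurable borel" unfolding rescale_def by measurable
  from measurable_sets[OF this A] have m: "rescale a -` A \<in> sets borel" by simp
  have "emeasure lborel A = (\<integral>\<^sup>+y. indicator A y \<partial>lborel)" using A by simp
  also have "\<dots> = ennreal \<bar>1 / wt a\<bar> * (\<integral>\<^sup>+y. indicator A (?t + (1 / wt a) * y) \<partial>lborel)"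
    using A wt_pos[of a] by (intro nn_integral_real_affine) auto
  also have "\<dots> = ennreal (1 / wt a) * (\<integral>\<^sup>+y. indicator (rescale a -` A) y \<partial>lborel)"
    using wt_pos[of a] by (simp add: r indicator_def vimage_def)
  also have "\<dots> = ennreal (1 / wt a) * emeasure lborel (rescale a -` A)" using m by simp
  finally have "ennreal (wt a) * emeasure lborel A
      = (ennreal (wt a) * ennreal (1 / wt a)) * emeasure lborel (rescale a -` A)"
    by (simp add: mult.assoc)
  also have "ennreal (wt a) * ennreal (1 / wt a) = 1"
    using wt_pos[of a] by (simp add: ennreal_mult[symmetric])
  finally show ?thesis by simp
qed

text \<open>The points of \<open>[0, \<psi> (tail a))\<close> that code a path in \<open>\<sigma>\<^sup>-\<^sup>1 S\<close> with first arrow \<open>a\<close> are those that are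
  stretched to a code of a path in \<open>S\<close>.\<close>

lemma coded_measure_conformal:
  assumes v: "\<psi> v > 0"
  shows "conformal G F \<beta> coded_measure"
proof (rule conformalI)
  show "emeasure coded_measure (inf_paths G) \<noteq> 0"
  proof
    assume "emeasure coded_measure (inf_paths G) = 0"
    moreover have "emeasure coded_measure (vertex_cyl G v) \<le> emeasure coded_measure (inf_paths G)"
      by (intro emeasure_mono) (auto simp: sets_coded_measure vertex_cyl_def intro: sets.top[of "path_borel G", simplified])
    ultimately show False using v by (simp add: coded_measure_vertex)
  qed
  fix a S assume a: "a \<in> arcs G" and S: "S \<in> sets (path_borel G)"
  let ?T = "{p \<in> inf_paths G. path_shift p \<in> S} \<inter> arrow_cyl G a"
  let ?Z = "S \<inter> vertex_cyl G (head G a)"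
  have T: "?T \<in> sets (path_borel G)"
    using shift_preimage_measurable[OF S] arrow_cyl_measurable by (rule sets.Int)
  have Z: "?Z \<in> sets (path_borel G)" using S vertex_cyl_measurable by (rule sets.Int)
  have "{y \<in> {0..<\<psi> (tail G a)}. coded_path (tail G a) y \<in> ?T}
      = rescale a -` {z \<in> {0..<\<psi> (head G a)}. coded_path (head G a) z \<in> ?Z}"
  proof (intro equalityI subsetI)
    fix y assume y: "y \<in> {y \<in> {0..<\<psi> (tail G a)}. coded_path (tail G a) y \<in> ?T}"
    with cells_cover[of y "tail G a"] obtain b where b: "b \<in> out_arcs G (tail G a)" "y \<in> cell b" by blast
    from coded_path_step[OF b] y have "b = a" by (auto simp: arrow_cyl_def)
    with b have r: "rescale a y \<in> {0..<\<psi> (head G a)}" by (simp only: rescale_in_iff)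
    from y coded_path_step[OF b] \<open>b = a\<close> have "coded_path (head G a) (rescale a y) \<in> S"
      by (simp add: path_shift_cons)
    with r coded_path_in[OF r] show "y \<in> rescale a -` {z \<in> {0..<\<psi> (head G a)}. coded_path (head G a) z \<in> ?Z}"
      by blast
  next
    fix y assume y: "y \<in> rescale a -` {z \<in> {0..<\<psi> (head G a)}. coded_path (head G a) z \<in> ?Z}"
    then have c: "y \<in> cell a" using rescale_in_iff[of a y] by blast
    have o: "a \<in> out_arcs G (tail G a)" using a by simp
    with c have "y \<in> {0..<\<psi> (tail G a)}" using cell_subset by blast
    moreover from y have "coded_path (head G a) (rescale a y) \<in> ?Z" by blast
    ultimately show "y \<in> {y \<in> {0..<\<psi> (tail G a)}. coded_path (tail G a) y \<in> ?T}"
      using coded_path_step[OF o c] cons_in_inf_paths[OF a] by (auto simp: path_shift_cons arrow_cyl_def)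
  qed
  then have "coded_mass (tail G a) ?T = ennreal (wt a) * coded_mass (head G a) ?Z"
    unfolding coded_mass_def by (simp only: emeasure_lborel_rescale[OF coded_set_measurable[OF Z]])
  moreover have "?T \<subseteq> vertex_cyl G (tail G a)" by (auto simp: arrow_cyl_def vertex_cyl_def)
  ultimately show "emeasure coded_measure ?T = ennreal (wt a) * emeasure coded_measure ?Z"
    using a T Z emeasure_coded_measure_vertex[OF T, of "tail G a"]
      emeasure_coded_measure_vertex[OF Z, of "head G a"] by simp
qed (auto simp: sets_coded_measure space_coded_measure coded_measure_vertex)

end

lemma (in weighted_digraph) exists_conformal:
  assumes "\<And>v. 0 \<le> \<psi> v" and "\<And>v. (\<Sum>a\<in>out_arcs G v. wt a * \<psi> (head G a)) = \<psi> v" and "\<psi> v > 0"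
  shows "\<exists>m. conformal G F \<beta> m \<and> (\<forall>v. emeasure m (vertex_cyl G v) = ennreal (\<psi> v))"
proof -
  interpret harmonic_coding G F \<beta> \<psi> by unfold_locales (fact assms)+
  show ?thesis using coded_measure_conformal[OF assms(3)] coded_measure_vertex by blast
qed

section \<open>Compact sets of functions\<close>

lemma compact_function_box: "compact {f :: 'i \<Rightarrow> real. \<forall>i. 0 \<le> f i \<and> f i \<le> b i}"
proof -
  have "compactin (product_topology (\<lambda>i. euclidean) UNIV) (PiE UNIV (\<lambda>i. {0..b i}))"
    unfolding compactin_PiE by simp
  then have "compact (PiE UNIV (\<lambda>i. {0..b i}))" by (simp add: euclidean_product_topology)
  moreover have "PiE UNIV (\<lambda>i. {0..b i}) = {f. \<forall>i. 0 \<le> f i \<and> f i \<le> b i}" by auto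
  ultimately show ?thesis by simp
qed

text \<open>Each limit point of the sequence \<open>k\<close> satisfies all the closed constraints. The finite intersection
  property gives this without convergent subsequences, which a compact space need not have.\<close>

lemma compact_meets_eventual_constraints:
  fixes k :: "nat \<Rightarrow> 'b::topological_space"
  assumes "compact S" and S: "\<And>n. k n \<in> S" and "\<And>T. T \<in> \<F> \<Longrightarrow> closed T"
    and ev: "\<And>T. T \<in> \<F> \<Longrightarrow> \<forall>\<^sub>F n in sequentially. k n \<in> T"
  shows "S \<inter> \<Inter>\<F> \<noteq> {}"
proof (rule compact_imp_fip[OF assms(1)])
  fix \<F>' assume F: "finite \<F>'" "\<F>' \<subseteq> \<F>"
  then have "\<forall>\<^sub>F n in sequentially. \<forall>T\<in>\<F>'. k n \<in> T"
    by (intro eventually_ball_finite) (auto intro: ev)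
  then obtain n where "\<forall>T\<in>\<F>'. k n \<in> T" by (auto simp: eventually_sequentially)
  with S show "S \<inter> \<Inter>\<F>' \<noteq> {}" by blast
qed (fact assms)

text \<open>A lexicographic maximum is an extreme point. Maximise the first coordinate, then the second
  coordinate among the functions where the first is maximal, and so on; by compactness some
  function survives all steps. If it is a proper convex combination, both constituents must have
  the maximal value at each step, so they agree with it in all coordinates. The coordinates outside
  the countable set \<open>V\<close> vanish.\<close>

lemma compact_function_set_has_extreme_point:
  fixes K :: "('i \<Rightarrow> real) set"
  assumes K: "compact K" "K \<noteq> {}" and V: "countable V"
    and supp: "\<And>f i. f \<in> K \<Longrightarrow> i \<notin> V \<Longrightarrow> f i = 0"
  shows "\<exists>f\<in>K. \<forall>g\<in>K. \<forall>h\<in>K. \<forall>t. 0 < t \<longrightarrow> t < 1 \<longrightarrow> (\<forall>i. f i = t * g i + (1 - t) * h i) \<longrightarrow> g = f"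
proof -
  define e where "e = from_nat_into V"
  have V_range: "V \<subseteq> range e"
    unfolding e_def using V by (cases "V = {}") (auto simp: range_from_nat_into)
  define L where "L = rec_nat K (\<lambda>n M. {f \<in> M. \<forall>g\<in>M. g (e n) \<le> f (e n)})"
  have L0: "L 0 = K" and LS: "L (Suc n) = {f \<in> L n. \<forall>g\<in>L n. g (e n) \<le> f (e n)}" for n
    by (simp_all add: L_def)
  \<comment> \<open>The relative closedness is recorded because the intersection of all \<open>L n\<close> is formed inside \<open>K\<close>.\<close>
  have cn: "compact (L n) \<and> L n \<noteq> {} \<and> (\<exists>C. closed C \<and> L n = K \<inter> C)" for n
  proof (induction n)
    case (Suc n)
    have "continuous_on (L n) (\<lambda>f. f (e n))"
      by (rule continuous_on_subset[OF continuous_on_product_coordinates]) simp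
    with Suc continuous_attains_sup[of "L n" "\<lambda>f. f (e n)"]
    obtain f where f: "f \<in> L n" "\<forall>g\<in>L n. g (e n) \<le> f (e n)" by auto
    let ?U = "{g :: 'i \<Rightarrow> real. f (e n) \<le> g (e n)}"
    have LU: "L (Suc n) = L n \<inter> ?U" unfolding LS using f by (auto intro: order_trans)
    have U: "closed ?U"
      by (intro closed_Collect_le continuous_on_const continuous_on_product_coordinates)
    from Suc obtain C where C: "closed C" "L n = K \<inter> C" by blast
    have "compact (L (Suc n))" unfolding LU using Suc U by (intro compact_Int_closed) simp_all
    moreover have "f \<in> L (Suc n)" unfolding LU using f(1) by simp
    moreover have "closed (C \<inter> ?U)" "L (Suc n) = K \<inter> (C \<inter> ?U)"
      unfolding LU C(2) using C(1) U by (auto intro: closed_Int)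
    ultimately show ?case by blast
  qed (use K in \<open>auto simp: L0 intro: exI[of _ UNIV]\<close>)
  have dec: "L n \<subseteq> L m" if "m \<le> n" for m n
    using that by (induction n rule: dec_induct) (auto simp: LS)
  from cn have "\<forall>n. \<exists>C. closed C \<and> L n = K \<inter> C" by blast
  then obtain C where C: "\<And>n. closed (C n)" "\<And>n. L n = K \<inter> C n" by metis
  have "K \<inter> (\<Inter>n\<in>UNIV. C n) \<noteq> {}"
  proof (rule compact_imp_fip_image[OF K(1) C(1)])
    fix I :: "nat set" assume I: "finite I"
    then obtain N where N: "\<And>i. i \<in> I \<Longrightarrow> i \<le> N" by (auto simp: finite_nat_set_iff_bounded_le)
    from cn[of N] obtain g where g: "g \<in> L N" by blast
    have "g \<in> C i" if "i \<in> I" for i using dec[OF N[OF that]] g C(2)[of i] by blast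
    moreover have "g \<in> K" using g C(2)[of N] by blast
    ultimately show "K \<inter> (\<Inter>i\<in>I. C i) \<noteq> {}" by blast
  qed
  then obtain f where "f \<in> K" "\<And>n. f \<in> C n" by blast
  then have f: "f \<in> K" "\<And>n. f \<in> L n" using C(2) by simp_all
  have "g = f" if gh: "g \<in> K" "h \<in> K" and t: "0 < t" "t < 1"
    and conv: "\<And>i. f i = t * g i + (1 - t) * h i" for g h t
  proof -
    have both: "g \<in> L n \<and> h \<in> L n" for n
    proof (induction n)
      case (Suc n)
      from f(2)[of "Suc n"] Suc have le: "g (e n) \<le> f (e n)" "h (e n) \<le> f (e n)" by (auto simp: LS)
      have "t * (f (e n) - g (e n)) + (1 - t) * (f (e n) - h (e n)) = 0"
        using conv[of "e n"] by (simp add: algebra_simps)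
      moreover have "0 \<le> t * (f (e n) - g (e n))" "0 \<le> (1 - t) * (f (e n) - h (e n))" using le t by simp_all
      ultimately have "t * (f (e n) - g (e n)) = 0" "(1 - t) * (f (e n) - h (e n)) = 0" by linarith+
      with t have "g (e n) = f (e n)" "h (e n) = f (e n)" by auto
      with f(2)[of "Suc n"] Suc show ?case by (auto simp: LS)
    qed (simp add: L0 gh)
    have "g i = f i" for i
    proof (cases "i \<in> V")
      case True
      then obtain n where n: "i = e n" using V_range by auto
      have "g \<in> L (Suc n)" "f \<in> L (Suc n)" using both[of "Suc n"] f(2) by blast+
      then show ?thesis unfolding LS n by (blast intro: antisym)
    next
      case False
      show ?thesis using supp[OF gh(1) False] supp[OF f(1) False] by simp
    qed
    then show ?thesis by blast
  qed
  with f(1) show ?thesis by blast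
qed

section \<open>Extremal measures on a given end\<close>

context transient_digraph begin

definition real_op :: "('v \<Rightarrow> real) \<Rightarrow> 'v \<Rightarrow> real" where
  "real_op f v = (\<Sum>a\<in>out_arcs G v. wt a * f (head G a))"

lemma mat_op_ennreal:
  assumes "\<And>u. 0 \<le> f u"
  shows "mat_op (\<lambda>u. ennreal (f u)) v = ennreal (real_op f v)"
  using assms less_imp_le[OF wt_pos]
  by (simp add: mat_op_def real_op_def ennreal_mult[symmetric] sum_ennreal del: in_out_arcs_conv)

lemma real_op_outside: "v \<notin> verts G \<Longrightarrow> real_op f v = 0"
  by (simp add: real_op_def out_arcs_outside)

text \<open>One bound \<open>b\<close> for all superharmonic functions; it is what makes the normalised ones a bounded family.\<close>

lemma harnack_real:
  assumes x: "x \<in> verts G"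
  shows "\<exists>b :: 'v \<Rightarrow> real. \<forall>f. (\<forall>v. 0 \<le> f v \<and> real_op f v \<le> f v) \<longrightarrow> (\<forall>v. v \<notin> verts G \<longrightarrow> f v = 0) \<longrightarrow>
    (\<forall>v. f v \<le> b v * f x)"
proof -
  have "\<exists>c::real. c > 0 \<and> (\<forall>f. mat_op f \<le> f \<longrightarrow> ennreal c * f v \<le> f x)" if "v \<in> verts G" for v
    using harnack[OF x that] .
  then obtain c :: "'v \<Rightarrow> real"
    where c: "\<And>v. v \<in> verts G \<Longrightarrow> c v > 0 \<and> (\<forall>f. mat_op f \<le> f \<longrightarrow> ennreal (c v) * f v \<le> f x)" by metis
  have "f v \<le> inverse (c v) * f x"
    if f: "\<forall>v. 0 \<le> f v \<and> real_op f v \<le> f v" and v: "v \<in> verts G" for f v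
  proof -
    have "mat_op (\<lambda>u. ennreal (f u)) \<le> (\<lambda>u. ennreal (f u))"
      using f by (auto simp: le_fun_def mat_op_ennreal intro: ennreal_leI)
    with c[OF v] have "ennreal (c v) * ennreal (f v) \<le> ennreal (f x)" by (metis (no_types, lifting))
    then have "ennreal (c v * f v) \<le> ennreal (f x)" using c[OF v] f by (simp add: ennreal_mult)
    then have "c v * f v \<le> f x" using f by (simp add: ennreal_le_iff)
    then show ?thesis using c[OF v] by (simp add: field_simps)
  qed
  then show ?thesis
    by (intro exI[of _ "\<lambda>v. if v \<in> verts G then inverse (c v) else 0"]) auto
qed

definition green_real :: "'v \<Rightarrow> 'v \<Rightarrow> real" where
  "green_real v w = enn2real (green v w)"

text \<open>Each constraint alone is a closed condition on finitely many values of \<open>f\<close>, and holds for all but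
  finitely many Martin kernels along \<open>p\<close>.\<close>

definition end_constraints :: "(nat \<Rightarrow> 'a) \<Rightarrow> ('v \<Rightarrow> real) set set" where
  "end_constraints p = insert {f. f (tail G (p 0)) = 1}
     (range (\<lambda>v. {f. real_op f v = f v}) \<union>
      {{f. f v \<le> (\<Sum>h\<in>H. green_real v h * f h)} | H v.
         H \<in> finite_vertex_sets \<and> v \<in> verts G - H - end_component H p})"

definition end_states :: "(nat \<Rightarrow> 'a) \<Rightarrow> ('v \<Rightarrow> real) set" where
  "end_states p = {f. \<forall>v. 0 \<le> f v} \<inter> \<Inter>(end_constraints p)"

lemma end_states_iff:
  "f \<in> end_states p \<longleftrightarrow> (\<forall>v. 0 \<le> f v) \<and> f (tail G (p 0)) = 1 \<and> (\<forall>v. real_op f v = f v) \<and>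
     (\<forall>H\<in>finite_vertex_sets. \<forall>v\<in>verts G - H - end_component H p.
        f v \<le> (\<Sum>h\<in>H. green_real v h * f h))"
  unfolding end_states_def end_constraints_def by blast

lemma closed_end_constraint: "T \<in> end_constraints p \<Longrightarrow> closed T"
  unfolding end_constraints_def real_op_def
  by (auto intro!: closed_Collect_eq closed_Collect_le continuous_intros continuous_on_product_coordinates)

lemma end_states_compact:
  assumes p: "p \<in> inf_paths G"
  shows "compact (end_states p)"
proof -
  from harnack_real[OF inf_paths_vertex[OF p, of 0]] obtain b where
    b: "\<And>f v. (\<forall>v. 0 \<le> f v \<and> real_op f v \<le> f v) \<Longrightarrow> (\<forall>v. v \<notin> verts G \<longrightarrow> f v = 0) \<Longrightarrow> f v \<le> b v * f (tail G (p 0))"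
    by blast
  let ?B = "{f :: 'v \<Rightarrow> real. \<forall>v. 0 \<le> f v \<and> f v \<le> b v}"
  have "f v \<le> b v" if f: "f \<in> end_states p" for f v
  proof -
    from f have *: "\<forall>v. 0 \<le> f v" "\<forall>v. real_op f v = f v" "f (tail G (p 0)) = 1" unfolding end_states_iff by blast+
    then have "\<forall>v. v \<notin> verts G \<longrightarrow> f v = 0" using real_op_outside[of _ f] by metis
    with b[of f v] * show ?thesis by simp
  qed
  then have "end_states p = ?B \<inter> \<Inter>(end_constraints p)" unfolding end_states_def by blast
  moreover have "compact (?B \<inter> \<Inter>(end_constraints p))"
    by (intro compact_Int_closed compact_function_box closed_Inter ballI closed_end_constraint)
  ultimately show ?thesis by simp
qed

lemma green_real_nonneg: "0 \<le> green_real v w"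
  by (simp add: green_real_def)

lemma ennreal_green_real: "w \<in> verts G \<Longrightarrow> ennreal (green_real v w) = green v w"
  using green_finite[of v w] green_outside[of v w]
  by (cases "v \<in> verts G") (auto simp: green_real_def less_top[symmetric] ennreal_enn2real)

lemma green_real_op:
  assumes "w \<in> verts G"
  shows "real_op (\<lambda>u. green_real u w) v = green_real v w - (if v = w then 1 else 0)"
proof -
  have "green v w = unit_vec w v + mat_op (\<lambda>u. ennreal (green_real u w)) v"
    unfolding ennreal_green_real[OF assms] by (rule green_eq)
  also have "\<dots> = ennreal ((if v = w then 1 else 0) + real_op (\<lambda>u. green_real u w) v)"
    by (subst mat_op_ennreal) (auto simp: green_real_def unit_vec_def real_op_def ennreal_plus sum_nonneg less_imp_le[OF wt_pos])
  finally have "ennreal (green_real v w) = \<dots>" using ennreal_green_real[OF assms] by simp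
  moreover have "0 \<le> real_op (\<lambda>u. green_real u w) v"
    unfolding real_op_def green_real_def by (intro sum_nonneg mult_nonneg_nonneg less_imp_le[OF wt_pos]) simp_all
  ultimately show ?thesis by (subst (asm) ennreal_inj) (auto simp: green_real_def)
qed

lemma green_real_pos: "v \<in> verts G \<Longrightarrow> w \<in> verts G \<Longrightarrow> green_real v w > 0"
  using green_pos[of v w] ennreal_green_real[of w v] by (metis ennreal_less_zero_iff)

text \<open>\<open>K n\<close> is the Martin kernel with pole at the \<open>n\<close>-th vertex \<open>w\<close> of \<open>p\<close>. It is harmonic except at its
  pole, which leaves each finite set of vertices. It satisfies the inequality that belongs to \<open>H\<close>
  as soon as \<open>w\<close> is in the component of \<open>p\<close>, by \<open>green_le_through\<close>.\<close>

lemma end_states_nonempty: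
  assumes p: "p \<in> wandering G"
  shows "end_states p \<noteq> {}"
proof -
  have pG: "p \<in> inf_paths G" using p by (simp add: wandering_def)
  let ?x = "tail G (p 0)" and ?w = "\<lambda>n. tail G (p n)"
  have x: "?x \<in> verts G" and w: "?w n \<in> verts G" for n using inf_paths_vertex[OF pG] by auto
  define K where "K n v = green_real v (?w n) / green_real ?x (?w n)" for n v
  have pos: "green_real ?x (?w n) > 0" for n by (rule green_real_pos[OF x w])
  have K_nonneg: "0 \<le> K n v" for n v using pos[of n] by (simp add: K_def green_real_def)
  have K_op: "real_op (K n) v = K n v - (if v = ?w n then 1 else 0) / green_real ?x (?w n)" for n v
  proof -
    have "real_op (K n) v = real_op (\<lambda>u. green_real u (?w n)) v / green_real ?x (?w n)"
      unfolding real_op_def K_def by (simp add: sum_divide_distrib)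
    then show ?thesis unfolding green_real_op[OF w] by (simp add: K_def diff_divide_distrib)
  qed
  have K_super: "real_op (K n) v \<le> K n v" for n v using K_op[of n v] pos[of n] by simp
  have K_out: "K n v = 0" if "v \<notin> verts G" for n v
    using that w[of n] by (simp add: K_def green_real_def green_outside)
  have K_x: "K n ?x = 1" for n using pos[of n] by (simp add: K_def)
  from harnack_real[OF x] obtain b where
    b: "\<And>f v. (\<forall>v. 0 \<le> f v \<and> real_op f v \<le> f v) \<Longrightarrow> (\<forall>v. v \<notin> verts G \<longrightarrow> f v = 0) \<Longrightarrow> f v \<le> b v * f ?x"
    by blast
  let ?B = "{f :: 'v \<Rightarrow> real. \<forall>v. 0 \<le> f v \<and> f v \<le> b v}"
  have "?B \<inter> \<Inter>(end_constraints p) \<noteq> {}"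
  proof (rule compact_meets_eventual_constraints[where k = K])
    show "compact ?B" by (rule compact_function_box)
    show "K n \<in> ?B" for n
    proof -
      have "K n v \<le> b v" for v
        using b[of "K n" v] by (simp add: K_nonneg K_super K_out K_x)
      then show ?thesis by (simp add: K_nonneg)
    qed
    show "closed T" if "T \<in> end_constraints p" for T using that by (rule closed_end_constraint)
    fix T assume "T \<in> end_constraints p"
    then consider "T = {f. f ?x = 1}" | v where "T = {f. real_op f v = f v}"
      | H v where "H \<in> finite_vertex_sets" "v \<in> verts G - H - end_component H p"
        "T = {f. f v \<le> (\<Sum>h\<in>H. green_real v h * f h)}"
      unfolding end_constraints_def by blast
    then show "\<forall>\<^sub>F n in sequentially. K n \<in> T"
    proof cases
      case 1
      then show ?thesis using K_x by simp
    next
      case 2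
      have "\<forall>\<^sub>F n in sequentially. v \<noteq> ?w n"
      proof (cases "v \<in> verts G")
        case True
        then obtain N where "\<And>i. i \<ge> N \<Longrightarrow> ?w i \<notin> {v}"
          using wandering_end_component[OF p, of "{v}"] by auto
        then show ?thesis by (auto simp: eventually_sequentially intro!: exI[of _ N])
      next
        case False
        then have "v \<noteq> ?w n" for n using w[of n] by auto
        then show ?thesis by simp
      qed
      then show ?thesis unfolding 2 by eventually_elim (simp add: K_op)
    next
      case 3
      then have H: "finite H" "H \<subseteq> verts G" by (auto simp: finite_vertex_sets_def)
      from wandering_in_end_component[OF p H]
      have "\<forall>\<^sub>F n in sequentially. ?w n \<in> end_component H p"
        by (auto simp: eventually_in_def eventually_sequentially)
      then show ?thesis
      proof eventually_elim
        case (elim n)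
        have "green v (?w n) \<le> (\<Sum>h\<in>H. green v h * green h (?w n))"
          using end_component_closed[OF p H] elim 3(2) H(1)
          by (intro green_le_through[where D = "verts G - H - end_component H p"]) auto
        also have "\<dots> = (\<Sum>h\<in>H. ennreal (green_real v h * green_real h (?w n)))"
        proof (intro sum.cong refl)
          fix h assume "h \<in> H"
          then have "h \<in> verts G" using H by auto
          then show "green v h * green h (?w n) = ennreal (green_real v h * green_real h (?w n))"
            using w[of n] by (simp add: ennreal_mult green_real_nonneg ennreal_green_real)
        qed
        also have "\<dots> = ennreal (\<Sum>h\<in>H. green_real v h * green_real h (?w n))"
          by (intro sum_ennreal) (simp add: green_real_def)
        finally have "ennreal (green_real v (?w n)) \<le> ennreal (\<Sum>h\<in>H. green_real v h * green_real h (?w n))"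
          by (simp add: ennreal_green_real w)
        then have "green_real v (?w n) \<le> (\<Sum>h\<in>H. green_real v h * green_real h (?w n))"
          by (subst (asm) ennreal_le_iff) (auto intro!: sum_nonneg simp: green_real_def)
        then have "K n v \<le> (\<Sum>h\<in>H. green_real v h * green_real h (?w n)) / green_real ?x (?w n)"
          unfolding K_def using pos[of n] by (intro divide_right_mono) auto
        also have "\<dots> = (\<Sum>h\<in>H. green_real v h * K n h)" by (simp add: sum_divide_distrib K_def)
        finally show ?case unfolding 3(3) by (simp add: green_real_def)
      qed
    qed
  qed
  then show ?thesis unfolding end_states_def by blast
qed

text \<open>The measure of the paths from \<open>v\<close> that are in \<open>D\<close> at time \<open>n\<close> is at most \<open>A\<^sup>n\<close> applied to a potential,
  and this tends to \<open>0\<close>.\<close>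

lemma eventually_in_null_of_potential:
  assumes m: "conformal G F \<beta> m" and H: "finite H" "H \<subseteq> verts G"
    and bound: "\<And>u. u \<in> D \<Longrightarrow> emeasure m (vertex_cyl G u) \<le> (\<Sum>h\<in>H. green u h * ennreal (c h))"
  shows "eventually_in D \<in> null_sets m"
proof (rule eventually_in_null[OF m])
  fix v assume v: "v \<in> verts G"
  let ?q = "\<lambda>u. \<Sum>h\<in>H. green u h * ennreal (c h)"
  have "(\<lambda>n. (mat_op ^^ n) ?q v) \<longlonglongrightarrow> (\<Sum>h\<in>H. ennreal (c h) * 0)"
    unfolding mat_op_pow_sum mult.commute[of "green _ _"] mat_op_pow_cmult
    using H v green_finite by (intro tendsto_sum ennreal_tendsto_cmult mat_op_pow_green_tendsto_0) auto
  then have lim: "(\<lambda>n. (mat_op ^^ n) ?q v) \<longlonglongrightarrow> 0" by simp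
  have le: "emeasure m {p \<in> vertex_cyl G v. tail G (p n) \<in> D} \<le> (mat_op ^^ n) ?q v" for n
    unfolding conformal_visit[OF m]
    using mat_op_pow_mono[of "\<lambda>u. if u \<in> D then emeasure m (vertex_cyl G u) else 0" ?q n] bound
    by (auto simp: le_fun_def)
  show "(\<lambda>n. emeasure m {p \<in> vertex_cyl G v. tail G (p n) \<in> D}) \<longlonglongrightarrow> 0"
    by (rule tendsto_sandwich[OF _ _ tendsto_const lim]) (simp_all add: le)
qed

lemma end_state_ennreal_bound:
  assumes f: "f \<in> end_states p" and H: "H \<in> finite_vertex_sets"
    and v: "v \<in> verts G - H - end_component H p"
  shows "ennreal (f v) \<le> (\<Sum>h\<in>H. green v h * ennreal (f h))"
proof -
  from H have Hv: "h \<in> verts G" if "h \<in> H" for h using that by (auto simp: finite_vertex_sets_def)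
  from f H v have nn: "\<And>v. 0 \<le> f v" and le: "f v \<le> (\<Sum>h\<in>H. green_real v h * f h)"
    unfolding end_states_iff green_real_def by blast+
  from le have "ennreal (f v) \<le> ennreal (\<Sum>h\<in>H. green_real v h * f h)" by (rule ennreal_leI)
  also have "\<dots> = (\<Sum>h\<in>H. ennreal (green_real v h * f h))"
    by (rule sum_ennreal[symmetric]) (simp add: nn green_real_def)
  also have "\<dots> = (\<Sum>h\<in>H. green v h * ennreal (f h))"
  proof (intro sum.cong refl)
    fix h assume "h \<in> H"
    then show "ennreal (green_real v h * f h) = green v h * ennreal (f h)"
      using ennreal_green_real[OF Hv, of h v] nn by (simp add: ennreal_mult green_real_def)
  qed
  finally show ?thesis .
qed

text \<open>The inequalities for \<open>f\<close> bound the smaller function \<open>g\<close> by the potential of the values of \<open>f\<close> on \<open>H\<close>;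
  by \<open>potential_le\<close> the values of \<open>g\<close> itself suffice.\<close>

lemma end_state_dominated:
  assumes p: "p \<in> wandering G" and f: "f \<in> end_states p"
    and g: "\<And>v. 0 \<le> g v" "\<And>v. g v \<le> f v" "\<And>v. real_op g v = g v" and pos: "g (tail G (p 0)) > 0"
  shows "(\<lambda>v. g v / g (tail G (p 0))) \<in> end_states p"
proof -
  let ?x = "tail G (p 0)"
  have "g v / g ?x \<le> (\<Sum>h\<in>H. green_real v h * (g h / g ?x))"
    if H: "H \<in> finite_vertex_sets" and v: "v \<in> verts G - H - end_component H p" for H v
  proof -
    from H have H': "finite H" "H \<subseteq> verts G" by (auto simp: finite_vertex_sets_def)
    let ?D = "verts G - H - end_component H p"
    have "ennreal (g v) \<le> (\<Sum>h\<in>H. green v h * ennreal (g h))"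
    proof (rule potential_le[of ?D H "\<lambda>v. ennreal (g v)" f])
      show "mat_op (\<lambda>v. ennreal (g v)) = (\<lambda>v. ennreal (g v))"
        using g by (simp add: fun_eq_iff mat_op_ennreal)
      show "ennreal (g u) \<le> (\<Sum>h\<in>H. green u h * ennreal (f h))" if "u \<in> ?D" for u
        using end_state_ennreal_bound[OF f H that] g(2)[of u] by (meson ennreal_leI order_trans)
    qed (use end_component_closed[OF p H'] H' v green_finite in auto)
    also have "\<dots> = (\<Sum>h\<in>H. ennreal (green_real v h * g h))"
      using H' ennreal_green_real[of _ v] g(1) by (intro sum.cong refl) (auto simp: ennreal_mult green_real_def)
    also have "\<dots> = ennreal (\<Sum>h\<in>H. green_real v h * g h)"
      by (rule sum_ennreal) (simp add: g green_real_def)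
    finally have "g v \<le> (\<Sum>h\<in>H. green_real v h * g h)"
      by (subst (asm) ennreal_le_iff) (auto intro!: sum_nonneg simp: green_real_def g)
    then have "g v / g ?x \<le> (\<Sum>h\<in>H. green_real v h * g h) / g ?x"
      using pos by (intro divide_right_mono) auto
    then show ?thesis by (simp add: sum_divide_distrib green_real_def)
  qed
  moreover have "real_op (\<lambda>v. g v / g ?x) v = g v / g ?x" for v
    using g(3)[of v] by (simp add: real_op_def sum_divide_distrib[symmetric])
  ultimately show ?thesis unfolding end_states_iff using g(1) pos by simp
qed

text \<open>Let \<open>f\<close> be an extreme point of the compact set and \<open>m\<close> its measure. A conformal measure \<open>m' \<le> m\<close> has a
  harmonic function \<open>g \<le> f\<close>, and \<open>h = f - g\<close> is harmonic as well. After normalisation at the first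
  vertex of \<open>p\<close> both belong to the compact set, and \<open>f\<close> is a convex combination of them, whence
  \<open>g = t f\<close> with \<open>t = g x\<close>. By uniqueness \<open>m'\<close> is \<open>t\<close> times \<open>m\<close>.\<close>

lemma exists_extremal_on_end:
  assumes au: "almost_undirected G" and p: "p \<in> wandering G"
  shows "\<exists>m. extremal_conformal G F \<beta> m \<and> concentrated_on m (end_equiv G `` {p})"
proof -
  have pG: "p \<in> inf_paths G" using p by (simp add: wandering_def)
  let ?x = "tail G (p 0)"
  have x: "?x \<in> verts G" by (rule inf_paths_vertex[OF pG])
  have supp: "f v = 0" if "f \<in> end_states p" "v \<notin> verts G" for f v
    using that real_op_outside[of v f] unfolding end_states_iff by metis
  have "\<exists>f\<in>end_states p. \<forall>g\<in>end_states p. \<forall>h\<in>end_states p. \<forall>t. 0 < t \<longrightarrow> t < 1 \<longrightarrow>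
      (\<forall>v. f v = t * g v + (1 - t) * h v) \<longrightarrow> g = f"
    by (rule compact_function_set_has_extreme_point[OF end_states_compact[OF pG]
          end_states_nonempty[OF p] countable_verts]) (rule supp)
  then obtain f where f: "f \<in> end_states p"
    and extreme: "\<And>g h t. g \<in> end_states p \<Longrightarrow> h \<in> end_states p \<Longrightarrow> 0 < t \<Longrightarrow> t < 1 \<Longrightarrow>
      (\<And>v. f v = t * g v + (1 - t) * h v) \<Longrightarrow> g = f" by auto
  from f have nn: "\<And>v. 0 \<le> f v" and fx: "f ?x = 1" and fop: "\<And>v. real_op f v = f v"
    unfolding end_states_iff by blast+
  from exists_conformal[of f ?x] nn fx fop obtain m
    where m: "conformal G F \<beta> m" and mf: "\<And>v. emeasure m (vertex_cyl G v) = ennreal (f v)"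
    unfolding real_op_def by auto
  from harnack_real[OF x] obtain b where
    b: "\<And>f v. (\<forall>v. 0 \<le> f v \<and> real_op f v \<le> f v) \<Longrightarrow> (\<forall>v. v \<notin> verts G \<longrightarrow> f v = 0) \<Longrightarrow> f v \<le> b v * f ?x"
    by blast
  have harnack': "g v \<le> b v * g ?x" if "\<And>v. 0 \<le> g v" "\<And>v. real_op g v = g v" for g v
  proof (rule b)
    show "\<forall>v. v \<notin> verts G \<longrightarrow> g v = 0" using that(2) real_op_outside[of _ g] by metis
  qed (simp add: that)
  have "concentrated_on m (end_equiv G `` {p})"
  proof (rule concentrated_on_endI[OF au m p])
    fix H assume H: "H \<in> finite_vertex_sets"
    then have H': "finite H" "H \<subseteq> verts G" by (auto simp: finite_vertex_sets_def)
    show "eventually_in (verts G - H - end_component H p) \<in> null_sets m"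
      by (rule eventually_in_null_of_potential[OF m H', where c = f])
        (simp only: mf end_state_ennreal_bound[OF f H])
  qed
  moreover have "\<exists>c::real. c > 0 \<and> m' = scale_measure (ennreal c) m"
    if m': "conformal G F \<beta> m'" and le: "m' \<le> m" for m'
  proof -
    define g where "g v = enn2real (emeasure m' (vertex_cyl G v))" for v
    have mg: "emeasure m' (vertex_cyl G v) = ennreal (g v)" for v
      using conformal_vertex_finite[OF m', of v] by (simp add: g_def less_top)
    have g_nn: "0 \<le> g v" for v by (simp add: g_def)
    have "emeasure m' (vertex_cyl G v) \<le> emeasure m (vertex_cyl G v)" for v
      using le conformal_sets[OF m] conformal_sets[OF m'] vertex_cyl_measurable[of v] by (simp add: le_measure le_fun_def)
    then have g_le: "g v \<le> f v" for v by (simp add: mg mf nn ennreal_le_iff)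
    have g_op: "real_op g v = g v" for v
    proof -
      have "mat_op (\<lambda>u. ennreal (g u)) v = ennreal (g v)"
        using conformal_harmonic[OF m'] unfolding mg by metis
      then have "ennreal (real_op g v) = ennreal (g v)" by (simp add: mat_op_ennreal g_nn)
      moreover have "0 \<le> real_op g v"
        unfolding real_op_def by (intro sum_nonneg mult_nonneg_nonneg less_imp_le[OF wt_pos] g_nn)
      ultimately show ?thesis using g_nn by simp
    qed
    define t where "t = g ?x"
    have t_pos: "t > 0"
    proof (rule ccontr)
      assume "\<not> t > 0"
      with g_nn[of ?x] have "g ?x = 0" by (simp add: t_def)
      with harnack'[OF g_nn g_op] have "g v \<le> 0" for v by simp
      with conformal_vertex_nonzero[OF m'] show False unfolding mg by (metis ennreal_less_zero_iff not_less)
    qed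
    define h where "h v = f v - g v" for v
    have h_nn: "0 \<le> h v" for v using g_le[of v] by (simp add: h_def)
    have h_op: "real_op h v = h v" for v
      using fop[of v] g_op[of v] by (simp add: h_def real_op_def right_diff_distrib sum_subtractf)
    have hx: "h ?x = 1 - t" by (simp add: h_def t_def fx)
    \<comment> \<open>If \<open>t = 1\<close>, then \<open>h\<close> vanishes at \<open>x\<close> and hence everywhere; there is no convex combination to use.\<close>
    have "g v = t * f v" for v
    proof (cases "t = 1")
      case True
      with harnack'[OF h_nn h_op, of v] h_nn[of v] hx have "h v = 0" by simp
      with True show ?thesis by (simp add: h_def)
    next
      case False
      with h_nn[of ?x] hx have t1: "t < 1" by simp
      have G: "(\<lambda>v. g v / t) \<in> end_states p"
        unfolding t_def by (rule end_state_dominated[OF p f g_nn g_le g_op]) (use t_pos t_def in simp)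
      have "h v \<le> f v" for v using g_nn[of v] by (simp add: h_def)
      from end_state_dominated[OF p f h_nn this h_op] have H: "(\<lambda>v. h v / (1 - t)) \<in> end_states p"
        using t1 by (simp add: hx)
      have "(\<lambda>v. g v / t) = f"
        by (rule extreme[OF G H t_pos t1]) (use t_pos t1 in \<open>simp add: h_def\<close>)
      then have "g v / t = f v" by (rule fun_cong)
      then show ?thesis using t_pos by (simp add: field_simps)
    qed
    then have "m' = scale_measure (ennreal t) m"
      using t_pos nn by (intro conformal_unique[OF m' conformal_scale[OF m t_pos]]) (simp add: mg mf ennreal_mult)
    with t_pos show ?thesis by blast
  qed
  ultimately show ?thesis using m unfolding extremal_conformal_def by blast
qed

end

theorem theorem8p27:
  fixes G :: "('v, 'a) pre_digraph" and F :: "'a \<Rightarrow> real" and \<beta> :: real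
  assumes "countable_digraph G"
    and "row_finite G"
    and "strongly_connected_digraph G"
    and "almost_undirected G"
    and "transient_on (verts G) (pot_matrix G F \<beta>)"
  shows "\<exists>f :: (nat \<Rightarrow> 'a) measure \<Rightarrow> (nat \<Rightarrow> 'a) set.
           f ` {m. extremal_conformal G F \<beta> m} = end_space G \<and>
           (\<forall>m. extremal_conformal G F \<beta> m \<longrightarrow>
              (\<forall>E \<in> end_space G. concentrated_on m E \<longleftrightarrow> E = f m))"
proof -
  interpret wf_digraph G using assms(1) by (simp add: countable_digraph_def)
  have "finite (out_arcs G v)" for v
  proof (cases "v \<in> verts G")
    case False
    then have "out_arcs G v = {}" by auto
    then show ?thesis by (simp only: finite.emptyI)
  qed (use assms(2) in \<open>simp add: row_finite_def\<close>)
  then interpret transient_digraph G F \<beta>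
    using assms(1,3,5) by unfold_locales (auto simp: countable_digraph_def strongly_connected_digraph_def)
  note au = assms(4)
  have unique: "\<exists>!E. E \<in> end_space G \<and> concentrated_on m E" if "extremal_conformal G F \<beta> m" for m
    using extremal_concentrated[OF au that] concentrated_unique[OF au, of m] that
    unfolding extremal_conformal_def by blast
  define f where "f m = (THE E. E \<in> end_space G \<and> concentrated_on m E)" for m
  have f: "f m \<in> end_space G" "concentrated_on m (f m)" if "extremal_conformal G F \<beta> m" for m
    using theI'[OF unique[OF that]] unfolding f_def by blast+
  have conc: "concentrated_on m E \<longleftrightarrow> E = f m" if "extremal_conformal G F \<beta> m" "E \<in> end_space G" for m E
    using f[OF that(1)] unique[OF that(1)] that(2) by blast
  have "E \<in> f ` {m. extremal_conformal G F \<beta> m}" if E: "E \<in> end_space G" for E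
  proof -
    from E obtain p where p: "p \<in> wandering G" "E = end_equiv G `` {p}"
      unfolding end_space_def by (rule quotientE)
    from exists_extremal_on_end[OF au p(1)] obtain m
      where "extremal_conformal G F \<beta> m" "concentrated_on m E" unfolding p(2) by blast
    with conc E show ?thesis by blast
  qed
  with f conc show ?thesis by (intro exI[of _ f]) blast
qed

end
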